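(* Let $0\le\beta<1$, and set $\widetilde L:=[e|\log p|]$, $\widetilde M:=[eNp|\log p|]$. Let $P^{\mathcal P-\mathcal P}_{N,\widetilde M,\widetilde L}$ be the distribution on $N\times\widetilde M$ binary matrices $C_{N,\widetilde M}=(c_{i,a})$ under which the entries $c_{i,a}$ are independent Bernoulli random variables with $\Pr(c_{i,a}=1)=\widetilde L/\widetilde M$, i.e. $P^{\mathcal P-\mathcal P}_{N,\widetilde M,\widetilde L}(C)=\prod_{a=1}^{\widetilde M}\prod_{i=1}^N(\widetilde L/\widetilde M)^{c_{i,a}}(1-\widetilde L/\widetilde M)^{1-c_{i,a}}$. Then $$\lim_{N\to\infty\vert\beta}\sum_{C_{N,\widetilde M}}P^{\mathcal P-\mathcal P}_{N,\widetilde M,\widetilde L}(C_{N,\widetilde M})\,\frac{T_{\widetilde M,C_{N,\widetilde M},p}}{Np|\log p|}=e.$$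
   Context: Probabilistic group testing with two-stage algorithms. For an integer $N\ge1$ and $p\in(0,1)$, a configuration $X=(x_1,\dots,x_N)\in\{0,1\}^N$ is drawn from $\mu_p(X)=\prod_{i} p^{x_i}(1-p)^{1-x_i}$. A first stage with $M$ tests is an $N\times M$ binary matrix $C_{N,M}=(c_{i,a})$; variable $i$ belongs to test $a$ iff $c_{i,a}=1$. Test outcome $T_a=0$ if $c_{i,a}x_i=0$ for all $i$, else $T_a=1$. Variable $i$ is a sure zero if some $a$ has $c_{i,a}=1$ and $T_a=0$; it is a sure one if $x_i=1$ and some $a$ with $c_{i,a}=1$ has every other $j$ with $c_{j,a}=1$ a sure zero. $\mathcal U_0$ is the set of $i$ with $x_i=0$ not sure zeros, $\mathcal U_1$ the set of $i$ with $x_i=1$ not sure ones. $T_{M,C_{N,M},p}:=M+\sum_X\mu_p(X)(|\mathcal U_0|+|\mathcal U_1|)$. $[x]$ denotes the integer part, $\log$ the natural logarithm. For $\beta>0$, $\lim_{N\to\infty\vert\beta}f(N,p):=\lim_{N\to\infty}f(N,N^{-\beta})$; for $\beta=0$, $\lim_{N\to\infty\vert 0}f(N,p):=\lim_{p\to0}\lim_{N\to\infty}f(N,p)$. *)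

theory Defs
  imports "HOL-Analysis.Analysis"
begin

text \<open>Variables are indexed by 0..<N, tests by 0..<M.
  A configuration X is represented by the set of indices i with x_i = 1 (a subset of {0..<N}).
  A first-stage matrix C is represented by the set of pairs (i,a) with c_{i,a} = 1
  (a subset of {0..<N} \<times> {0..<M}).\<close>

definition mu :: "nat \<Rightarrow> real \<Rightarrow> nat set \<Rightarrow> real" where
  "mu N p X = (\<Prod>i\<in>{0..<N}. if i \<in> X then p else 1 - p)"

definition test_out :: "(nat \<times> nat) set \<Rightarrow> nat set \<Rightarrow> nat \<Rightarrow> bool" where
  "test_out C X a = (\<exists>i\<in>X. (i, a) \<in> C)"

definition sure_zero :: "nat \<Rightarrow> (nat \<times> nat) set \<Rightarrow> nat set \<Rightarrow> nat \<Rightarrow> bool" where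
  "sure_zero M C X i = (\<exists>a<M. (i, a) \<in> C \<and> \<not> test_out C X a)"

definition sure_one :: "nat \<Rightarrow> nat \<Rightarrow> (nat \<times> nat) set \<Rightarrow> nat set \<Rightarrow> nat \<Rightarrow> bool" where
  "sure_one N M C X i = (i \<in> X \<and> (\<exists>a<M. (i, a) \<in> C \<and>
      (\<forall>j<N. j \<noteq> i \<and> (j, a) \<in> C \<longrightarrow> sure_zero M C X j)))"

definition U0 :: "nat \<Rightarrow> nat \<Rightarrow> (nat \<times> nat) set \<Rightarrow> nat set \<Rightarrow> nat set" where
  "U0 N M C X = {i. i < N \<and> i \<notin> X \<and> \<not> sure_zero M C X i}"

definition U1 :: "nat \<Rightarrow> nat \<Rightarrow> (nat \<times> nat) set \<Rightarrow> nat set \<Rightarrow> nat set" where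
  "U1 N M C X = {i. i < N \<and> i \<in> X \<and> \<not> sure_one N M C X i}"

text \<open>T_{M,C,p}: number of first-stage tests plus expected number of second-stage tests.\<close>
definition Tcost :: "nat \<Rightarrow> nat \<Rightarrow> (nat \<times> nat) set \<Rightarrow> real \<Rightarrow> real" where
  "Tcost N M C p = real M +
     (\<Sum>X\<in>Pow {0..<N}. mu N p X * real (card (U0 N M C X) + card (U1 N M C X)))"

definition Ltil :: "real \<Rightarrow> nat" where
  "Ltil p = nat \<lfloor>exp 1 * \<bar>ln p\<bar>\<rfloor>"

definition Mtil :: "nat \<Rightarrow> real \<Rightarrow> nat" where
  "Mtil N p = nat \<lfloor>exp 1 * real N * p * \<bar>ln p\<bar>\<rfloor>"

definition PP :: "nat \<Rightarrow> nat \<Rightarrow> nat \<Rightarrow> (nat \<times> nat) set \<Rightarrow> real" where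
  "PP N M L C = (\<Prod>a\<in>{0..<M}. \<Prod>i\<in>{0..<N}.
      if (i, a) \<in> C then real L / real M else 1 - real L / real M)"

definition avg_cost :: "nat \<Rightarrow> real \<Rightarrow> real" where
  "avg_cost N p = (\<Sum>C\<in>Pow ({0..<N} \<times> {0..<Mtil N p}).
      PP N (Mtil N p) (Ltil p) C * (Tcost N (Mtil N p) C p / (real N * p * \<bar>ln p\<bar>)))"

end

theory Submission
  imports Defs "HOL-Real_Asymp.Real_Asymp"
begin

text \<open>
  The tests are independent, so given the configuration a zero stays undetermined with probability
  exactly \<open>(1 - q (1 - q) ^ k) ^ M\<close>, where \<open>k\<close> is the number of ones and \<open>q = L / M\<close>.  Since \<open>k\<close> is
  about \<open>N p\<close>, this is of order \<open>exp (- L / e)\<close>, that is \<open>O(p)\<close>; bounding the probability for a one by 1,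
  the second stage costs \<open>O(N p)\<close>, which is negligible against the first-stage cost \<open>M \<approx> e N p |ln p|\<close>.
  A Chernoff bound for the upper tail of \<open>k\<close> makes this an explicit estimate for the distance of the
  averaged cost to \<open>e\<close> that covers both limits at once.  For \<open>\<beta> = 0\<close> the inner limit must moreover exist.
  For this the probability for a one is computed exactly by conditioning on the negative tests: it is
  a nested average over two binomial variables, both of which concentrate.
\<close>

section \<open>Averages over random subsets\<close>

definition bernoulli_avg :: "'a set \<Rightarrow> real \<Rightarrow> ('a set \<Rightarrow> real) \<Rightarrow> real" where
  "bernoulli_avg A q f = (\<Sum>C\<in>Pow A. (\<Prod>x\<in>A. if x \<in> C then q else 1 - q) * f C)"

lemma bernoulli_avg_empty [simp]: "bernoulli_avg {} q f = f {}"
  by (simp add: bernoulli_avg_def)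

lemma bernoulli_avg_cong:
  assumes "\<And>C. C \<subseteq> A \<Longrightarrow> f C = g C"
  shows "bernoulli_avg A q f = bernoulli_avg A q g"
  unfolding bernoulli_avg_def by (rule sum.cong) (auto simp: assms)

lemma bernoulli_avg_add:
  "bernoulli_avg A q (\<lambda>C. f C + g C) = bernoulli_avg A q f + bernoulli_avg A q g"
  unfolding bernoulli_avg_def by (simp add: distrib_left sum.distrib)

lemma bernoulli_avg_diff:
  "bernoulli_avg A q (\<lambda>C. f C - g C) = bernoulli_avg A q f - bernoulli_avg A q g"
  unfolding bernoulli_avg_def by (simp add: right_diff_distrib sum_subtractf)

lemma bernoulli_avg_cmult: "bernoulli_avg A q (\<lambda>C. c * f C) = c * bernoulli_avg A q f"
  unfolding bernoulli_avg_def by (simp add: sum_distrib_left mult_ac)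

lemma bernoulli_avg_sum: "bernoulli_avg A q (\<lambda>C. \<Sum>i\<in>I. f i C) = (\<Sum>i\<in>I. bernoulli_avg A q (f i))"
  unfolding bernoulli_avg_def sum_distrib_left by (rule sum.swap)

lemma bernoulli_avg_swap:
  "bernoulli_avg A q (\<lambda>C. bernoulli_avg B r (\<lambda>D. f C D)) =
   bernoulli_avg B r (\<lambda>D. bernoulli_avg A q (\<lambda>C. f C D))"
  unfolding bernoulli_avg_def sum_distrib_left
  by (subst sum.swap) (simp add: mult_ac)

lemma bernoulli_avg_insert:
  assumes "finite A" "x \<notin> A"
  shows "bernoulli_avg (insert x A) q f =
    q * bernoulli_avg A q (\<lambda>C. f (insert x C)) + (1 - q) * bernoulli_avg A q f"
proof -
  have inj: "inj_on (insert x) (Pow A)"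
    using assms(2) by (auto simp: inj_on_def)
  have disj: "Pow A \<inter> insert x ` Pow A = {}"
    using assms(2) by auto
  have weight: "(\<Prod>y\<in>A. if y \<in> insert x C then q else 1 - q) = (\<Prod>y\<in>A. if y \<in> C then q else 1 - q)" for C
    using assms(2) by (intro prod.cong) auto
  have notin: "x \<notin> C" if "C \<in> Pow A" for C
    using that assms(2) by auto
  show ?thesis
    unfolding bernoulli_avg_def Pow_insert
    using assms
    by (simp add: sum.union_disjoint disj sum.reindex[OF inj] weight sum_distrib_left mult.assoc
        del: insert_iff) (auto intro!: sum.cong dest: notin)
qed

lemma bernoulli_avg_const [simp]: "finite A \<Longrightarrow> bernoulli_avg A q (\<lambda>C. c) = c"
  by (induction A rule: finite_induct) (auto simp: bernoulli_avg_insert algebra_simps)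

lemma bernoulli_avg_Un:
  assumes "finite A" "finite B" "A \<inter> B = {}"
  shows "bernoulli_avg (A \<union> B) q f = bernoulli_avg A q (\<lambda>C. bernoulli_avg B q (\<lambda>D. f (C \<union> D)))"
  using assms
proof (induction A arbitrary: f rule: finite_induct)
  case (insert x A)
  then show ?case
    by (simp add: bernoulli_avg_insert)
qed auto

lemma bernoulli_avg_image:
  assumes "finite A" "inj_on h A"
  shows "bernoulli_avg (h ` A) q f = bernoulli_avg A q (\<lambda>C. f (h ` C))"
  using assms
proof (induction A arbitrary: f rule: finite_induct)
  case (insert x A)
  then show ?case by (simp add: bernoulli_avg_insert)
qed auto

lemma bernoulli_avg_Int:
  assumes "finite A" "B \<subseteq> A"
  shows "bernoulli_avg A q (\<lambda>C. f (C \<inter> B)) = bernoulli_avg B q f"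
proof -
  have fin: "finite B" "finite (A - B)" using assms finite_subset by auto
  have "bernoulli_avg A q (\<lambda>C. f (C \<inter> B)) = bernoulli_avg (B \<union> (A - B)) q (\<lambda>C. f (C \<inter> B))"
    using assms by (simp add: Un_absorb1)
  also have "\<dots> = bernoulli_avg B q (\<lambda>C. bernoulli_avg (A - B) q (\<lambda>D. f ((C \<union> D) \<inter> B)))"
    using fin by (subst bernoulli_avg_Un) auto
  also have "\<dots> = bernoulli_avg B q (\<lambda>C. bernoulli_avg (A - B) q (\<lambda>D. f C))"
    by (intro bernoulli_avg_cong arg_cong[where f = f]) auto
  finally show ?thesis using fin by simp
qed

lemma bernoulli_avg_if:
  assumes "finite A"
  shows "bernoulli_avg A q (\<lambda>C. if P C then u else v) =
    bernoulli_avg A q (\<lambda>C. of_bool (P C)) * u + (1 - bernoulli_avg A q (\<lambda>C. of_bool (P C))) * v"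
proof -
  have "bernoulli_avg A q (\<lambda>C. if P C then u else v) =
      bernoulli_avg A q (\<lambda>C. v + (u - v) * of_bool (P C))"
    by (intro bernoulli_avg_cong) simp
  then show ?thesis
    using assms by (simp add: bernoulli_avg_add bernoulli_avg_cmult) (simp add: algebra_simps)
qed

lemma bernoulli_avg_altdef:
  assumes "finite A"
  shows "bernoulli_avg A q f = (\<Sum>C\<in>Pow A. q ^ card C * (1 - q) ^ (card A - card C) * f C)"
  unfolding bernoulli_avg_def
proof (intro sum.cong refl arg_cong2[where f = "(*)"])
  fix C assume C: "C \<in> Pow A"
  have "(\<Prod>x\<in>A. if x \<in> C then q else 1 - q) = q ^ card (A \<inter> C) * (1 - q) ^ card (A - C)"
    using assms by (simp add: prod.If_cases Diff_eq)
  then show "(\<Prod>x\<in>A. if x \<in> C then q else 1 - q) = q ^ card C * (1 - q) ^ (card A - card C)"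
    using C assms by (simp add: Int_absorb1 card_Diff_subset finite_subset)
qed

lemma bernoulli_avg_Int_eq:
  assumes "finite A" "B \<subseteq> A" "S \<subseteq> B"
  shows "bernoulli_avg A q (\<lambda>C. of_bool (C \<inter> B = S)) = q ^ card S * (1 - q) ^ (card B - card S)"
proof -
  have B: "finite B" using assms finite_subset by auto
  have "bernoulli_avg A q (\<lambda>C. of_bool (C \<inter> B = S)) = bernoulli_avg B q (\<lambda>C. of_bool (C = S))"
    by (rule bernoulli_avg_Int[OF assms(1,2)])
  then show ?thesis
    using assms(3) B by (simp add: bernoulli_avg_altdef sum_mult_of_bool_eq Int_absorb1 Collect_conv_if)
qed

definition binomial_avg :: "nat \<Rightarrow> real \<Rightarrow> (nat \<Rightarrow> real) \<Rightarrow> real" where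
  "binomial_avg n x f = (\<Sum>k\<le>n. Bernstein n k x * f k)"

lemma bernoulli_avg_card:
  assumes "finite A"
  shows "bernoulli_avg A q (\<lambda>C. f (card C)) = binomial_avg (card A) q f"
proof -
  let ?weighted = "\<lambda>k. q ^ k * (1 - q) ^ (card A - k) * f k"
  have "bernoulli_avg A q (\<lambda>C. f (card C)) = (\<Sum>k\<le>card A. \<Sum>C\<in>{C \<in> Pow A. card C = k}. ?weighted (card C))"
    unfolding bernoulli_avg_altdef[OF assms] using assms by (subst sum.group) (auto intro: card_mono)
  also have "\<dots> = (\<Sum>k\<le>card A. real (card A choose k) * ?weighted k)"
    by (simp add: n_subsets[OF assms])
  finally show ?thesis unfolding binomial_avg_def Bernstein_def by (simp add: mult_ac)
qed

section \<open>Independence of the rows and columns of a random matrix\<close>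

lemma bernoulli_avg_rows:
  assumes "finite A" "finite B"
  shows "bernoulli_avg (A \<times> B) q (\<lambda>C. F {i\<in>A. P (C `` {i})}) =
    bernoulli_avg A (bernoulli_avg B q (\<lambda>D. of_bool (P D))) F"
  using assms(1)
proof (induction A arbitrary: F rule: finite_induct)
  case (insert i A)
  let ?x = "bernoulli_avg B q (\<lambda>D. of_bool (P D))"
  have rows: "{j\<in>insert i A. P ((Pair i ` D \<union> C) `` {j})} =
      (if P D then insert i {j\<in>A. P (C `` {j})} else {j\<in>A. P (C `` {j})})"
    if "C \<subseteq> A \<times> B" for C D
  proof -
    have "(Pair i ` D \<union> C) `` {i} = D" using that insert.hyps by auto
    moreover have "(Pair i ` D \<union> C) `` {j} = C `` {j}" if "j \<in> A" for j
      using that insert.hyps by auto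
    ultimately show ?thesis by auto
  qed
  have "bernoulli_avg (insert i A \<times> B) q (\<lambda>C. F {j\<in>insert i A. P (C `` {j})}) =
      bernoulli_avg (Pair i ` B \<union> A \<times> B) q (\<lambda>C. F {j\<in>insert i A. P (C `` {j})})"
    by (intro arg_cong[where f = "\<lambda>X. bernoulli_avg X q _"]) auto
  also have "\<dots> = bernoulli_avg B q (\<lambda>D. bernoulli_avg (A \<times> B) q
      (\<lambda>C. F {j\<in>insert i A. P ((Pair i ` D \<union> C) `` {j})}))"
    using insert.hyps assms(2) by (subst bernoulli_avg_Un) (auto simp: bernoulli_avg_image inj_on_def)
  also have "\<dots> = bernoulli_avg B q (\<lambda>D. if P D
      then bernoulli_avg (A \<times> B) q (\<lambda>C. F (insert i {j\<in>A. P (C `` {j})}))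
      else bernoulli_avg (A \<times> B) q (\<lambda>C. F {j\<in>A. P (C `` {j})}))"
    by (auto simp: rows simp del: insert_iff intro!: bernoulli_avg_cong)
  also have "\<dots> = ?x * bernoulli_avg A ?x (\<lambda>W. F (insert i W)) + (1 - ?x) * bernoulli_avg A ?x F"
    using assms(2) by (simp add: bernoulli_avg_if insert.IH insert.IH[of "\<lambda>W. F (insert i W)"])
  finally show ?case using insert.hyps by (simp add: bernoulli_avg_insert)
qed auto

lemma bernoulli_avg_card_empty_rows:
  assumes "finite A" "finite B"
  shows "bernoulli_avg (A \<times> B) q (\<lambda>C. f (card {i\<in>A. C `` {i} = {}})) =
    binomial_avg (card A) ((1 - q) ^ card B) f"
proof -
  have "bernoulli_avg B q (\<lambda>D. of_bool (D = {})) = bernoulli_avg B q (\<lambda>D. of_bool (D \<inter> B = {}))"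
    by (intro bernoulli_avg_cong) (simp add: Int_absorb2)
  also have "\<dots> = (1 - q) ^ card B"
    using assms(2) by (subst bernoulli_avg_Int_eq) auto
  finally show ?thesis
    using bernoulli_avg_rows[OF assms, of q "\<lambda>W. f (card W)" "\<lambda>D. D = {}"] assms(1)
    by (simp add: bernoulli_avg_card)
qed

definition pool :: "('i \<times> 't) set \<Rightarrow> 't \<Rightarrow> 'i set" where
  "pool C a = {i. (i, a) \<in> C}"

lemma prob_all_pools:
  assumes "finite I" "finite T"
  shows "bernoulli_avg (I \<times> T) q (\<lambda>C. of_bool (\<forall>a\<in>T. P (pool C a))) =
    bernoulli_avg I q (\<lambda>c. of_bool (P c)) ^ card T"
proof -
  let ?x = "bernoulli_avg I q (\<lambda>c. of_bool (P c))"
  have "bernoulli_avg (I \<times> T) q (\<lambda>C. of_bool (\<forall>a\<in>T. P (pool C a))) =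
      bernoulli_avg (prod.swap ` (T \<times> I)) q (\<lambda>C. of_bool (\<forall>a\<in>T. P (pool C a)))"
    by (simp only: product_swap)
  also have "\<dots> = bernoulli_avg (T \<times> I) q (\<lambda>C. of_bool ({a\<in>T. P (C `` {a})} \<inter> T = T))"
  proof (subst bernoulli_avg_image)
    have "pool (prod.swap ` C) a = C `` {a}" for C :: "('b \<times> 'a) set" and a
      by (force simp: pool_def)
    then show "bernoulli_avg (T \<times> I) q (\<lambda>C. of_bool (\<forall>a\<in>T. P (pool (prod.swap ` C) a))) =
        bernoulli_avg (T \<times> I) q (\<lambda>C. of_bool ({a\<in>T. P (C `` {a})} \<inter> T = T))"
      by (intro bernoulli_avg_cong arg_cong[where f = of_bool]) auto
  qed (use assms in auto)
  also have "\<dots> = bernoulli_avg T ?x (\<lambda>S. of_bool (S \<inter> T = T))"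
    by (rule bernoulli_avg_rows[OF assms(2,1)])
  also have "\<dots> = ?x ^ card T"
    using bernoulli_avg_Int_eq[OF assms(2) subset_refl subset_refl, of ?x] by simp
  finally show ?thesis .
qed

section \<open>Concentration of binomial averages\<close>

lemma binomial_avg_mono:
  assumes "0 \<le> x" "x \<le> 1" "\<And>k. k \<le> n \<Longrightarrow> f k \<le> g k"
  shows "binomial_avg n x f \<le> binomial_avg n x g"
  unfolding binomial_avg_def by (intro sum_mono mult_left_mono) (use assms Bernstein_nonneg in auto)

lemma binomial_avg_const [simp]: "binomial_avg n x (\<lambda>k. c) = c"
  unfolding binomial_avg_def by (simp flip: sum_distrib_right)

lemma binomial_avg_add: "binomial_avg n x (\<lambda>k. f k + g k) = binomial_avg n x f + binomial_avg n x g"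
  unfolding binomial_avg_def by (simp add: distrib_left sum.distrib)

lemma binomial_avg_cmult: "binomial_avg n x (\<lambda>k. c * f k) = c * binomial_avg n x f"
  unfolding binomial_avg_def by (simp add: sum_distrib_left mult_ac)

lemma binomial_avg_divide: "binomial_avg n x (\<lambda>k. f k / c) = binomial_avg n x f / c"
  unfolding binomial_avg_def by (simp add: sum_divide_distrib)

lemma binomial_avg_abs_le:
  assumes "0 \<le> x" "x \<le> 1"
  shows "\<bar>binomial_avg n x f\<bar> \<le> binomial_avg n x (\<lambda>k. \<bar>f k\<bar>)"
  unfolding binomial_avg_def
  by (rule order.trans[OF sum_abs]) (simp add: abs_mult Bernstein_nonneg assms)

lemma binomial_avg_bounds:
  assumes "0 \<le> x" "x \<le> 1" "\<And>k. k \<le> n \<Longrightarrow> f k \<in> {a..b}"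
  shows "binomial_avg n x f \<in> {a..b}"
  using binomial_avg_mono[of x n "\<lambda>_. a" f] binomial_avg_mono[of x n f "\<lambda>_. b"] assms by simp

lemma binomial_avg_mean: "binomial_avg n x real = real n * x"
  using sum_k_Bernstein[of n x] unfolding binomial_avg_def by (simp add: mult.commute)

lemma binomial_avg_power: "binomial_avg n x (\<lambda>k. y ^ k) = (1 - x + x * y) ^ n"
  unfolding binomial_avg_def Bernstein_def using binomial_ring[of "x * y" "1 - x" n]
  by (simp add: power_mult_distrib mult_ac add.commute)

lemma binomial_avg_variance: "binomial_avg n x (\<lambda>k. (real k - real n * x)\<^sup>2) = real n * x * (1 - x)"
proof -
  have "binomial_avg n x (\<lambda>k. (real k - real n * x)\<^sup>2) =
    binomial_avg n x (\<lambda>k. real k * (real k - 1) + ((1 - 2 * (real n * x)) * real k + (real n * x)\<^sup>2))"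
    by (simp add: power2_eq_square algebra_simps)
  also have "\<dots> = binomial_avg n x (\<lambda>k. real k * (real k - 1)) +
      ((1 - 2 * (real n * x)) * (real n * x) + (real n * x)\<^sup>2)"
    by (simp only: binomial_avg_add binomial_avg_cmult binomial_avg_mean binomial_avg_const)
  also have "binomial_avg n x (\<lambda>k. real k * (real k - 1)) = real n * (real n - 1) * x\<^sup>2"
    using sum_kk_Bernstein[of n x] unfolding binomial_avg_def by (simp add: mult_ac)
  finally show ?thesis by (simp add: power2_eq_square algebra_simps)
qed

lemma binomial_avg_chebyshev:
  assumes "0 \<le> x" "x \<le> 1" "t > 0"
  shows "binomial_avg n x (\<lambda>k. of_bool (t \<le> \<bar>real k - real n * x\<bar>)) \<le> real n * x * (1 - x) / t\<^sup>2"
proof -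
  have "binomial_avg n x (\<lambda>k. of_bool (t \<le> \<bar>real k - real n * x\<bar>)) \<le>
      binomial_avg n x (\<lambda>k. (real k - real n * x)\<^sup>2 / t\<^sup>2)"
  proof (intro binomial_avg_mono)
    fix k
    have "1 \<le> (real k - real n * x)\<^sup>2 / t\<^sup>2" if "t \<le> \<bar>real k - real n * x\<bar>"
      using power_mono[OF that, of 2] assms(3) by simp
    then show "of_bool (t \<le> \<bar>real k - real n * x\<bar>) \<le> (real k - real n * x)\<^sup>2 / t\<^sup>2"
      by simp
  qed (use assms in auto)
  then show ?thesis
    by (simp add: binomial_avg_divide binomial_avg_variance)
qed

lemma binomial_avg_chernoff:
  assumes x: "0 \<le> x" "x \<le> 1" and \<delta>: "0 \<le> \<delta>" "\<delta> \<le> 1"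
  shows "binomial_avg n x (\<lambda>k. of_bool ((1 + \<delta>) * (real n * x) < real k)) \<le>
    exp (- (\<delta>\<^sup>2 * (real n * x) / 4))"
proof -
  let ?t = "(1 + \<delta>) * (real n * x)"
  define \<theta> where "\<theta> = \<delta> / 2"
  have \<theta>: "0 \<le> \<theta>" "\<theta> \<le> 1" using \<delta> by (auto simp: \<theta>_def)
  have "binomial_avg n x (\<lambda>k. of_bool (?t < real k)) \<le>
      binomial_avg n x (\<lambda>k. exp (- (\<theta> * ?t)) * exp \<theta> ^ k)"
  proof (rule binomial_avg_mono[OF x])
    fix k
    have "exp (- (\<theta> * ?t)) * exp \<theta> ^ k = exp (\<theta> * (real k - ?t))"
      by (simp add: exp_of_nat_mult[symmetric] exp_add[symmetric] algebra_simps)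
    then show "of_bool (?t < real k) \<le> exp (- (\<theta> * ?t)) * exp \<theta> ^ k"
      using \<theta> by simp
  qed
  also have "\<dots> = exp (- (\<theta> * ?t)) * (1 + x * (exp \<theta> - 1)) ^ n"
    by (simp only: binomial_avg_cmult binomial_avg_power) (simp add: algebra_simps)
  also have "(1 + x * (exp \<theta> - 1)) ^ n \<le> exp (x * (exp \<theta> - 1)) ^ n"
    using x \<theta> exp_ge_add_one_self by (intro power_mono) auto
  also have "\<dots> = exp (real n * x * (exp \<theta> - 1))"
    by (simp add: exp_of_nat_mult[symmetric] mult.assoc)
  also have "\<dots> \<le> exp (real n * x * (\<theta> + \<theta>\<^sup>2))"
    using exp_bound[OF \<theta>] x by (simp add: mult_left_mono)
  finally have "binomial_avg n x (\<lambda>k. of_bool (?t < real k)) \<le>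
      exp (- (\<theta> * ?t)) * exp (real n * x * (\<theta> + \<theta>\<^sup>2))"
    by simp
  also have "\<dots> = exp (- (\<delta>\<^sup>2 * (real n * x) / 4))"
    unfolding exp_add[symmetric] by (simp add: \<theta>_def field_simps power2_eq_square)
  finally show ?thesis .
qed

lemma abs_binomial_avg_diff_le:
  assumes x: "0 \<le> x" "x \<le> 1" and "t > 0" "0 \<le> E" "0 \<le> D"
    and near: "\<And>k. k \<le> n \<Longrightarrow> \<bar>real k - real n * x\<bar> < t \<Longrightarrow> \<bar>f k - l\<bar> \<le> E"
    and bound: "\<And>k. k \<le> n \<Longrightarrow> \<bar>f k - l\<bar> \<le> D"
  shows "\<bar>binomial_avg n x f - l\<bar> \<le> E + D * (real n / t\<^sup>2)"
proof -
  let ?far = "\<lambda>k. of_bool (t \<le> \<bar>real k - real n * x\<bar>) :: real"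
  have "\<bar>binomial_avg n x f - l\<bar> = \<bar>binomial_avg n x (\<lambda>k. f k - l)\<bar>"
    using binomial_avg_add[of n x f "\<lambda>_. - l"] by simp
  also have "\<dots> \<le> binomial_avg n x (\<lambda>k. \<bar>f k - l\<bar>)"
    by (rule binomial_avg_abs_le[OF x])
  also have "\<dots> \<le> binomial_avg n x (\<lambda>k. E + D * ?far k)"
    by (intro binomial_avg_mono x) (use near bound assms in \<open>auto simp: not_le intro: add_increasing\<close>)
  also have "\<dots> = E + D * binomial_avg n x ?far"
    by (simp add: binomial_avg_add binomial_avg_cmult)
  also have "\<dots> \<le> E + D * (real n / t\<^sup>2)"
  proof -
    have "real n * (x * (1 - x)) \<le> real n * 1"
      using x by (intro mult_left_mono mult_le_one) auto
    then have "binomial_avg n x ?far \<le> real n / t\<^sup>2"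
      using x \<open>t > 0\<close>
      by (intro order.trans[OF binomial_avg_chebyshev] divide_right_mono) (auto simp: mult.assoc)
    then show ?thesis using \<open>0 \<le> D\<close> by (intro add_left_mono mult_left_mono)
  qed
  finally show ?thesis .
qed

text \<open>
  Since the points \<open>(a, k)\<close> with \<open>k / m a\<close> near \<open>y\<close> are again described by a filter, an integrand that is
  itself a binomial average is treated by the same theorem one level deeper.
\<close>
definition ratio_filter :: "'a filter \<Rightarrow> ('a \<Rightarrow> nat) \<Rightarrow> real \<Rightarrow> ('a \<times> nat) filter" where
  "ratio_filter F m y = inf (filtercomap fst F) (filtercomap (\<lambda>(a, k). real k / real (m a)) (nhds y))"

lemma filterlim_fst_ratio_filter: "filterlim fst F (ratio_filter F m y)"
  unfolding ratio_filter_def by (rule filterlim_mono[OF filterlim_filtercomap order_refl inf_le1])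

lemma tendsto_ratio_filter: "((\<lambda>z. real (snd z) / real (m (fst z))) \<longlongrightarrow> y) (ratio_filter F m y)"
  unfolding ratio_filter_def case_prod_beta'
  by (rule filterlim_mono[OF filterlim_filtercomap order_refl inf_le2])

lemma eventually_ratio_filterE:
  assumes "eventually P (ratio_filter F m y)"
  obtains \<eta> where "\<eta> > 0" "\<forall>\<^sub>F a in F. \<forall>k. \<bar>real k / real (m a) - y\<bar> < \<eta> \<longrightarrow> P (a, k)"
proof -
  obtain Q R where "eventually Q F" "eventually R (nhds y)"
    and P: "\<And>a k. Q a \<Longrightarrow> R (real k / real (m a)) \<Longrightarrow> P (a, k)"
    using assms by (fastforce simp: ratio_filter_def eventually_inf eventually_filtercomap)
  then obtain \<eta> where "\<eta> > 0" "\<And>u. \<bar>u - y\<bar> < \<eta> \<Longrightarrow> R u"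
    by (auto simp: eventually_nhds_metric dist_real_def)
  moreover from this have "\<forall>\<^sub>F a in F. \<forall>k. \<bar>real k / real (m a) - y\<bar> < \<eta> \<longrightarrow> P (a, k)"
    using \<open>eventually Q F\<close> by (auto elim!: eventually_mono intro: P)
  ultimately show ?thesis using that by blast
qed

lemma abs_binomial_avg_diff_le_ratio:
  assumes x: "0 \<le> x" "x \<le> 1" and "0 < m" "n \<le> m" "\<eta> > 0" "0 \<le> E" "0 \<le> D"
    and mean: "\<bar>real n * x / real m - y\<bar> < \<eta> / 2"
    and near: "\<And>k. \<bar>real k / real m - y\<bar> < \<eta> \<Longrightarrow> \<bar>f k - l\<bar> \<le> E"
    and bound: "\<And>k. k \<le> n \<Longrightarrow> \<bar>f k - l\<bar> \<le> D"
  shows "\<bar>binomial_avg n x f - l\<bar> \<le> E + D * (4 / \<eta>\<^sup>2) / real m"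
proof -
  let ?t = "\<eta> / 2 * real m"
  have "\<bar>binomial_avg n x f - l\<bar> \<le> E + D * (real n / ?t\<^sup>2)"
  proof (rule abs_binomial_avg_diff_le[OF x])
    fix k assume "\<bar>real k - real n * x\<bar> < ?t"
    then have "\<bar>real k - real n * x\<bar> / real m < \<eta> / 2"
      using assms by (simp add: divide_less_eq)
    then have "\<bar>real k / real m - real n * x / real m\<bar> < \<eta> / 2"
      by (simp add: diff_divide_distrib[symmetric] abs_divide)
    with mean have "\<bar>real k / real m - y\<bar> < \<eta>"
      unfolding abs_less_iff by linarith
    then show "\<bar>f k - l\<bar> \<le> E" by (rule near)
  qed (use assms in auto)
  also have "\<dots> \<le> E + D * (real m / ?t\<^sup>2)"
    using assms by (intro add_left_mono mult_left_mono divide_right_mono) auto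
  also have "\<dots> = E + D * (4 / \<eta>\<^sup>2) / real m"
    using assms by (simp add: power2_eq_square field_simps)
  finally show ?thesis .
qed

lemma binomial_avg_tendsto:
  fixes f :: "'a \<Rightarrow> nat \<Rightarrow> real" and n m :: "'a \<Rightarrow> nat"
  assumes x: "\<forall>\<^sub>F a in F. 0 \<le> x a \<and> x a \<le> 1"
    and m: "filterlim m at_top F"
    and nm: "\<forall>\<^sub>F a in F. n a \<le> m a"
    and y: "((\<lambda>a. real (n a) * x a / real (m a)) \<longlongrightarrow> y) F"
    and bound: "\<forall>\<^sub>F a in F. \<forall>k\<le>n a. \<bar>f a k\<bar> \<le> B"
    and f: "((\<lambda>z. f (fst z) (snd z)) \<longlongrightarrow> l) (ratio_filter F m y)"
  shows "((\<lambda>a. binomial_avg (n a) (x a) (f a)) \<longlongrightarrow> l) F"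
proof (rule tendstoI)
  fix \<epsilon> :: real assume "\<epsilon> > 0"
  have "\<forall>\<^sub>F z in ratio_filter F m y. \<bar>f (fst z) (snd z) - l\<bar> < \<epsilon> / 2"
    using tendstoD[OF f, of "\<epsilon> / 2"] \<open>\<epsilon> > 0\<close> by (simp add: dist_real_def)
  then obtain \<eta> where "\<eta> > 0" and near:
    "\<forall>\<^sub>F a in F. \<forall>k. \<bar>real k / real (m a) - y\<bar> < \<eta> \<longrightarrow> \<bar>f a k - l\<bar> < \<epsilon> / 2"
    by (auto elim!: eventually_ratio_filterE)
  define D where "D = \<bar>B\<bar> + \<bar>l\<bar>"
  have "((\<lambda>a. D * (4 / \<eta>\<^sup>2) / real (m a)) \<longlongrightarrow> 0) F"
    by (intro tendsto_divide_0[OF tendsto_const] filterlim_at_top_imp_at_infinity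
        filterlim_compose[OF filterlim_real_sequentially m])
  then have variance: "\<forall>\<^sub>F a in F. D * (4 / \<eta>\<^sup>2) / real (m a) < \<epsilon> / 2"
    by (rule order_tendstoD(2)) (use \<open>\<epsilon> > 0\<close> in simp)
  have mean: "\<forall>\<^sub>F a in F. \<bar>real (n a) * x a / real (m a) - y\<bar> < \<eta> / 2"
    using tendstoD[OF y, of "\<eta> / 2"] \<open>\<eta> > 0\<close> by (simp add: dist_real_def)
  have "\<forall>\<^sub>F a in F. m a > 0"
    using m eventually_compose_filterlim eventually_gt_at_top by blast
  with x nm bound near variance mean
  show "\<forall>\<^sub>F a in F. dist (binomial_avg (n a) (x a) (f a)) l < \<epsilon>"
  proof eventually_elim
    case (elim a)
    have "\<bar>f a k - l\<bar> \<le> D" if "k \<le> n a" for k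
    proof -
      have "\<bar>f a k\<bar> \<le> B" using elim that by blast
      then show ?thesis by (simp add: D_def)
    qed
    then have "\<bar>binomial_avg (n a) (x a) (f a) - l\<bar> \<le> \<epsilon> / 2 + D * (4 / \<eta>\<^sup>2) / real (m a)"
      using elim \<open>\<eta> > 0\<close> \<open>\<epsilon> > 0\<close>
      by (intro abs_binomial_avg_diff_le_ratio) (auto simp: D_def less_imp_le)
    then show ?case using elim by (simp add: dist_real_def)
  qed
qed

section \<open>Undetermined variables of a random design\<close>

definition negative_tests :: "nat \<Rightarrow> (nat \<times> nat) set \<Rightarrow> nat set \<Rightarrow> nat set" where
  "negative_tests M C X = {a\<in>{0..<M}. pool C a \<inter> X = {}}"

lemma not_sure_zero_iff_pools:
  "\<not> sure_zero M C X i \<longleftrightarrow> (\<forall>a\<in>{0..<M}. \<not> (i \<in> pool C a \<and> pool C a \<inter> X = {}))"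
  unfolding sure_zero_def test_out_def pool_def by fastforce

lemma U0_eq_negative_tests:
  "U0 N M C X = {j\<in>{0..<N} - X. C `` {j} \<inter> negative_tests M C X = {}}"
  unfolding U0_def not_sure_zero_iff_pools by (auto simp: negative_tests_def pool_def)

lemma not_sure_one_iff_pools:
  assumes "X \<subseteq> {0..<N}" "i \<in> X"
  shows "\<not> sure_one N M C X i \<longleftrightarrow> (\<forall>a\<in>{0..<M}. pool C a \<inter> (X \<union> U0 N M C X) \<noteq> {i})"
proof -
  have "\<not> sure_zero M C X j \<longleftrightarrow> j \<in> X \<union> U0 N M C X"
    if "j < N" "(j, a) \<in> C" for j a
    using that by (auto simp: U0_def not_sure_zero_iff_pools pool_def)
  then have "pool C a \<inter> (X \<union> U0 N M C X) = {i} \<longleftrightarrow>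
      (i, a) \<in> C \<and> (\<forall>j<N. j \<noteq> i \<and> (j, a) \<in> C \<longrightarrow> sure_zero M C X j)" for a
    using assms by (auto simp: pool_def U0_def subset_eq)
  then show ?thesis
    using assms(2) by (auto simp: sure_one_def)
qed

definition zero_miss_prob :: "nat \<Rightarrow> real \<Rightarrow> nat \<Rightarrow> real" where
  "zero_miss_prob M q k = (1 - q * (1 - q) ^ k) ^ M"

lemma prob_not_sure_zero:
  assumes "X \<subseteq> {0..<N}" "i < N" "i \<notin> X"
  shows "bernoulli_avg ({0..<N} \<times> {0..<M}) q (\<lambda>C. of_bool (\<not> sure_zero M C X i)) =
    zero_miss_prob M q (card X)"
proof -
  have "of_bool (\<not> (i \<in> c \<and> c \<inter> X = {})) = (1 - of_bool (c \<inter> insert i X = {i}) :: real)" for c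
    using assms(3) by auto
  then have "bernoulli_avg {0..<N} q (\<lambda>c. of_bool (\<not> (i \<in> c \<and> c \<inter> X = {}))) = 1 - q * (1 - q) ^ card X"
    using assms finite_subset[OF assms(1)]
    by (simp add: bernoulli_avg_diff bernoulli_avg_Int_eq)
  then show ?thesis
    unfolding not_sure_zero_iff_pools zero_miss_prob_def
    using prob_all_pools[of "{0..<N}" "{0..<M}" q "\<lambda>c. \<not> (i \<in> c \<and> c \<inter> X = {})"] by simp
qed

text \<open>
  For a configuration with \<open>k\<close> ones, \<open>r\<close> counts the negative tests and \<open>w\<close> the zeros that avoid all
  of them.  A given one is detected by a test that meets it but none of the other ones and none of
  these \<open>w\<close> zeros; \<open>detection_prob\<close> is the probability of this event for a test that is not negative.
  For \<open>q = 0\<close> it reads \<open>0 / 0 = 0\<close>, as it should; the truncation in \<open>k - 1\<close> is harmless because \<open>k \<ge> 1\<close>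
  as soon as there is a one.
\<close>
definition detection_prob :: "real \<Rightarrow> nat \<Rightarrow> nat \<Rightarrow> real" where
  "detection_prob q k w = q * (1 - q) ^ (k - 1 + w) / (1 - (1 - q) ^ k)"

definition one_miss_prob :: "nat \<Rightarrow> nat \<Rightarrow> real \<Rightarrow> nat \<Rightarrow> real" where
  "one_miss_prob N M q k = binomial_avg M ((1 - q) ^ k) (\<lambda>r.
     binomial_avg (N - k) ((1 - q) ^ r) (\<lambda>w. (1 - detection_prob q k w) ^ (M - r)))"

lemma prob_positive_undetecting_pool:
  assumes "finite I" "X \<subseteq> I" "W \<subseteq> I - X" "i \<in> X" and q: "0 \<le> q" "q \<le> 1"
  shows "bernoulli_avg I q (\<lambda>c. of_bool (c \<inter> X \<noteq> {} \<and> c \<inter> (X \<union> W) \<noteq> {i})) =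
    (1 - (1 - q) ^ card X) * (1 - detection_prob q (card X) (card W))"
proof -
  have fin: "finite X" "finite W" using assms finite_subset by blast+
  then have "card X > 0" using assms(4) card_gt_0_iff by blast
  moreover have "card (X \<union> W) = card X + card W"
    using assms(3) fin by (intro card_Un_disjoint) auto
  ultimately have "card (X \<union> W) - card {i} = card X - 1 + card W"
    by simp
  moreover have "of_bool (c \<inter> X \<noteq> {} \<and> c \<inter> (X \<union> W) \<noteq> {i}) =
      (1 - of_bool (c \<inter> X = {}) - of_bool (c \<inter> (X \<union> W) = {i}) :: real)" for c
    using assms(4) by auto
  moreover have "X \<union> W \<subseteq> I" "{i} \<subseteq> X \<union> W" using assms by auto
  ultimately have "bernoulli_avg I q (\<lambda>c. of_bool (c \<inter> X \<noteq> {} \<and> c \<inter> (X \<union> W) \<noteq> {i})) =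
      1 - (1 - q) ^ card X - q * (1 - q) ^ (card X - 1 + card W)"
    using assms by (simp add: bernoulli_avg_diff bernoulli_avg_Int_eq)
  also have "\<dots> = (1 - (1 - q) ^ card X) * (1 - detection_prob q (card X) (card W))"
  proof (cases "q = 0")
    case False
    then have "(1 - q) ^ card X < 1"
      using \<open>card X > 0\<close> q by (simp add: power_less_one_iff)
    then show ?thesis by (simp add: detection_prob_def field_simps)
  qed (simp add: detection_prob_def)
  finally show ?thesis .
qed

lemma prob_all_pools_positive_undetecting:
  assumes "finite I" "finite T" "X \<subseteq> I" "W \<subseteq> I - X" "i \<in> X" and q: "0 \<le> q" "q \<le> 1"
  shows "bernoulli_avg (I \<times> T) q
      (\<lambda>C. of_bool (\<forall>a\<in>T. pool C a \<inter> X \<noteq> {} \<and> pool C a \<inter> (X \<union> W) \<noteq> {i})) =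
    (1 - (1 - q) ^ card X) ^ card T * (1 - detection_prob q (card X) (card W)) ^ card T"
  using prob_all_pools[OF assms(1,2), of q "\<lambda>c. c \<inter> X \<noteq> {} \<and> c \<inter> (X \<union> W) \<noteq> {i}"] assms
  by (simp only: prob_positive_undetecting_pool power_mult_distrib)

lemma negative_tests_eq_and_not_sure_one_iff:
  assumes X: "X \<subseteq> {0..<N}" "i \<in> X" and R: "R \<subseteq> {0..<M}"
    and C: "C \<subseteq> X \<times> R" and D: "D \<subseteq> ({0..<N} - X) \<times> R" and E: "E \<subseteq> {0..<N} \<times> ({0..<M} - R)"
  defines "W \<equiv> {j\<in>{0..<N} - X. D `` {j} = {}}"
  shows "negative_tests M (C \<union> D \<union> E) X = R \<and> \<not> sure_one N M (C \<union> D \<union> E) X i \<longleftrightarrow>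
    C = {} \<and> (\<forall>a\<in>{0..<M} - R. pool E a \<inter> X \<noteq> {} \<and> pool E a \<inter> (X \<union> W) \<noteq> {i})"
proof -
  let ?G = "C \<union> D \<union> E"
  have outside: "pool ?G a = pool E a" if "a \<notin> R" for a
    using that C D by (auto simp: pool_def)
  have inside: "pool ?G a \<inter> X = pool C a" if "a \<in> R" for a
    using that C D E by (auto simp: pool_def)
  have "negative_tests M ?G X = R \<longleftrightarrow>
      (\<forall>a\<in>R. pool C a = {}) \<and> (\<forall>a\<in>{0..<M} - R. pool E a \<inter> X \<noteq> {})"
    using R outside inside unfolding negative_tests_def by blast
  also have "(\<forall>a\<in>R. pool C a = {}) \<longleftrightarrow> C = {}"
    using C by (auto simp: pool_def)
  finally have negative: "negative_tests M ?G X = R \<longleftrightarrow>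
      C = {} \<and> (\<forall>a\<in>{0..<M} - R. pool E a \<inter> X \<noteq> {})" .
  have "\<not> sure_one N M ?G X i \<longleftrightarrow> (\<forall>a\<in>{0..<M} - R. pool E a \<inter> (X \<union> W) \<noteq> {i})"
    if "negative_tests M ?G X = R"
  proof -
    have "?G `` {j} \<inter> R = D `` {j}" if "j \<notin> X" for j
      using that C D E by auto
    then have "U0 N M ?G X = W"
      unfolding U0_eq_negative_tests that W_def by auto
    moreover have "pool ?G a \<inter> (X \<union> W) \<noteq> {i}" if "a \<in> R" for a
      using that \<open>negative_tests M ?G X = R\<close> X(2) by (auto simp: negative_tests_def)
    ultimately show ?thesis
      unfolding not_sure_one_iff_pools[OF X] using outside R by blast
  qed
  then show ?thesis
    using negative by blast
qed

lemma prob_negative_tests_eq_and_not_sure_one: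
  assumes X: "X \<subseteq> {0..<N}" "i \<in> X" and R: "R \<subseteq> {0..<M}" and q: "0 \<le> q" "q \<le> 1"
  shows "bernoulli_avg ({0..<N} \<times> {0..<M}) q
      (\<lambda>C. of_bool (negative_tests M C X = R \<and> \<not> sure_one N M C X i)) =
    ((1 - q) ^ card X) ^ card R * (1 - (1 - q) ^ card X) ^ (M - card R) *
    binomial_avg (N - card X) ((1 - q) ^ card R) (\<lambda>w. (1 - detection_prob q (card X) w) ^ (M - card R))"
proof -
  let ?Y = "{0..<N} - X" and ?T = "{0..<M} - R"
  let ?W = "\<lambda>D. {j\<in>?Y. D `` {j} = {}}"
  let ?undetected = "\<lambda>W E. \<forall>a\<in>?T. pool E a \<inter> X \<noteq> {} \<and> pool E a \<inter> (X \<union> W) \<noteq> {i}"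
  let ?prob = "\<lambda>W. bernoulli_avg ({0..<N} \<times> ?T) q (\<lambda>E. of_bool (?undetected W E))"
  let ?positive = "(1 - (1 - q) ^ card X) ^ (M - card R)"
  let ?f = "\<lambda>w. (1 - detection_prob q (card X) w) ^ (M - card R)"
  have fin: "finite X" "finite R" using X R finite_subset by blast+
  have disjoint: "X \<times> R \<inter> ?Y \<times> R = {}" "(X \<times> R \<union> ?Y \<times> R) \<inter> {0..<N} \<times> ?T = {}"
    by auto
  have split: "{0..<N} \<times> {0..<M} = (X \<times> R \<union> ?Y \<times> R) \<union> {0..<N} \<times> ?T"
    using X R by auto
  have "bernoulli_avg ({0..<N} \<times> {0..<M}) q
      (\<lambda>C. of_bool (negative_tests M C X = R \<and> \<not> sure_one N M C X i)) =
    bernoulli_avg (X \<times> R) q (\<lambda>C. bernoulli_avg (?Y \<times> R) q (\<lambda>D. bernoulli_avg ({0..<N} \<times> ?T) q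
      (\<lambda>E. of_bool (negative_tests M (C \<union> D \<union> E) X = R \<and> \<not> sure_one N M (C \<union> D \<union> E) X i))))"
    unfolding split using fin disjoint
    by (simp only: bernoulli_avg_Un finite_Un finite_cartesian_product finite_Diff
        finite_atLeastLessThan)
  also have "\<dots> = bernoulli_avg (X \<times> R) q (\<lambda>C. bernoulli_avg (?Y \<times> R) q
      (\<lambda>D. bernoulli_avg ({0..<N} \<times> ?T) q (\<lambda>E. of_bool (C = {}) * of_bool (?undetected (?W D) E))))"
    by (intro bernoulli_avg_cong)
      (simp only: negative_tests_eq_and_not_sure_one_iff[OF X R] of_bool_conj)
  also have "\<dots> = bernoulli_avg (X \<times> R) q (\<lambda>C. bernoulli_avg (?Y \<times> R) q
      (\<lambda>D. ?prob (?W D)) * of_bool (C \<inter> X \<times> R = {}))"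
    by (intro bernoulli_avg_cong) (simp add: bernoulli_avg_cmult Int_absorb2)
  also have "\<dots> = bernoulli_avg (?Y \<times> R) q (\<lambda>D. ?prob (?W D)) * ((1 - q) ^ card X) ^ card R"
    using fin bernoulli_avg_Int_eq[of "X \<times> R" "X \<times> R" "{}" q]
    by (simp add: bernoulli_avg_cmult card_cartesian_product power_mult)
  also have "bernoulli_avg (?Y \<times> R) q (\<lambda>D. ?prob (?W D)) =
      bernoulli_avg (?Y \<times> R) q (\<lambda>D. ?positive * ?f (card (?W D)))"
  proof (intro bernoulli_avg_cong)
    fix D
    show "?prob (?W D) = ?positive * ?f (card (?W D))"
      using X R fin q by (subst prob_all_pools_positive_undetecting) (auto simp: card_Diff_subset)
  qed
  also have "\<dots> = ?positive * binomial_avg (N - card X) ((1 - q) ^ card R) ?f"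
    using bernoulli_avg_card_empty_rows[of ?Y R q ?f] X fin
    by (simp add: bernoulli_avg_cmult card_Diff_subset)
  finally show ?thesis by (simp only: mult_ac)
qed

lemma prob_not_sure_one:
  assumes X: "X \<subseteq> {0..<N}" "i \<in> X" and q: "0 \<le> q" "q \<le> 1"
  shows "bernoulli_avg ({0..<N} \<times> {0..<M}) q (\<lambda>C. of_bool (\<not> sure_one N M C X i)) =
    one_miss_prob N M q (card X)"
proof -
  let ?k = "card X" and ?T = "{0..<M}"
  let ?x = "(1 - q) ^ ?k"
  let ?f = "\<lambda>r. binomial_avg (N - ?k) ((1 - q) ^ r) (\<lambda>w. (1 - detection_prob q ?k w) ^ (M - r))"
  have "bernoulli_avg ({0..<N} \<times> ?T) q (\<lambda>C. of_bool (\<not> sure_one N M C X i)) =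
      bernoulli_avg ({0..<N} \<times> ?T) q (\<lambda>C. \<Sum>R\<in>Pow ?T.
        of_bool (negative_tests M C X = R \<and> \<not> sure_one N M C X i))"
  proof (intro bernoulli_avg_cong)
    fix C
    have "negative_tests M C X \<in> Pow ?T" by (auto simp: negative_tests_def)
    then show "of_bool (\<not> sure_one N M C X i) =
        (\<Sum>R\<in>Pow ?T. of_bool (negative_tests M C X = R \<and> \<not> sure_one N M C X i) :: real)"
      by (simp add: of_bool_conj sum_of_bool_mult_eq)
  qed
  also have "\<dots> = (\<Sum>R\<in>Pow ?T. ?x ^ card R * (1 - ?x) ^ (M - card R) * ?f (card R))"
    unfolding bernoulli_avg_sum using X q
    by (intro sum.cong refl prob_negative_tests_eq_and_not_sure_one) auto
  also have "\<dots> = bernoulli_avg ?T ?x (\<lambda>R. ?f (card R))"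
    by (simp add: bernoulli_avg_altdef)
  also have "\<dots> = one_miss_prob N M q ?k"
    using bernoulli_avg_card[of ?T ?x ?f] by (simp add: one_miss_prob_def)
  finally show ?thesis .
qed

lemma zero_miss_prob_bounds:
  assumes "0 \<le> q" "q \<le> 1"
  shows "zero_miss_prob M q k \<in> {0..1}"
proof -
  have "q * (1 - q) ^ k \<le> 1"
    using assms by (intro mult_le_one) (auto simp: power_le_one)
  then show ?thesis
    using assms by (auto simp: zero_miss_prob_def power_le_one)
qed

lemma detection_prob_bounds:
  assumes q: "0 \<le> q" "q \<le> 1"
  shows "detection_prob q k w \<in> {0..1}"
proof (cases "q = 0 \<or> k = 0")
  case False
  have "q * (1 - q) ^ (k - 1 + w) \<le> q * (1 - q) ^ (k - 1)"
    using q by (intro mult_left_mono power_decreasing) auto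
  also have "\<dots> = (1 - q) ^ (k - 1) - (1 - q) ^ k"
    using False by (cases k) (auto simp: algebra_simps)
  also have "\<dots> \<le> 1 - (1 - q) ^ k"
    using q by (simp add: power_le_one)
  finally show ?thesis
    using q False by (simp add: detection_prob_def power_less_one_iff divide_le_eq power_le_one)
qed (auto simp: detection_prob_def)

lemma one_miss_prob_bounds:
  assumes "0 \<le> q" "q \<le> 1"
  shows "one_miss_prob N M q k \<in> {0..1}"
  unfolding one_miss_prob_def using detection_prob_bounds[OF assms]
  by (intro binomial_avg_bounds) (use assms in \<open>auto simp: power_le_one\<close>)

definition mean_undetermined :: "nat \<Rightarrow> nat \<Rightarrow> real \<Rightarrow> nat \<Rightarrow> real" where
  "mean_undetermined N M q k = real (N - k) * zero_miss_prob M q k + real k * one_miss_prob N M q k"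

lemma mean_undetermined_bounds:
  assumes q: "0 \<le> q" "q \<le> 1" and "k \<le> N"
  shows "0 \<le> mean_undetermined N M q k"
    and "mean_undetermined N M q k \<le> real N * zero_miss_prob M q k + real k"
    and "mean_undetermined N M q k \<le> real N"
proof -
  have unit: "zero_miss_prob M q k \<in> {0..1}" "one_miss_prob N M q k \<in> {0..1}"
    using zero_miss_prob_bounds[OF q] one_miss_prob_bounds[OF q] .
  show "0 \<le> mean_undetermined N M q k"
    using unit by (simp add: mean_undetermined_def)
  show "mean_undetermined N M q k \<le> real N * zero_miss_prob M q k + real k"
    unfolding mean_undetermined_def
    using unit by (intro add_mono mult_right_mono) (auto simp: mult_left_le)
  have "mean_undetermined N M q k \<le> real (N - k) * 1 + real k * 1"
    unfolding mean_undetermined_def using unit by (intro add_mono mult_left_mono) auto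
  then show "mean_undetermined N M q k \<le> real N"
    using \<open>k \<le> N\<close> by (simp add: of_nat_diff)
qed

definition mean_second_stage :: "nat \<Rightarrow> nat \<Rightarrow> real \<Rightarrow> real \<Rightarrow> real" where
  "mean_second_stage N M q p = binomial_avg N p (mean_undetermined N M q)"

lemma bernoulli_avg_card_U0_U1:
  assumes X: "X \<subseteq> {0..<N}" and q: "0 \<le> q" "q \<le> 1"
  shows "bernoulli_avg ({0..<N} \<times> {0..<M}) q (\<lambda>C. real (card (U0 N M C X) + card (U1 N M C X))) =
    mean_undetermined N M q (card X)"
proof -
  let ?A = "{0..<N} \<times> {0..<M}"
  have finX: "finite X" using X finite_subset by blast
  have "U0 N M C X = {i\<in>{0..<N} - X. \<not> sure_zero M C X i}" for C
    by (auto simp: U0_def)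
  then have card_U0: "real (card (U0 N M C X)) = (\<Sum>i\<in>{0..<N} - X. of_bool (\<not> sure_zero M C X i))" for C
    by (simp add: sum_of_bool_eq Int_def)
  have "U1 N M C X = {i\<in>X. \<not> sure_one N M C X i}" for C
    using X by (auto simp: U1_def)
  then have card_U1: "real (card (U1 N M C X)) = (\<Sum>i\<in>X. of_bool (\<not> sure_one N M C X i))" for C
    using finX by (simp add: sum_of_bool_eq Int_def)
  have "bernoulli_avg ?A q (\<lambda>C. real (card (U0 N M C X) + card (U1 N M C X))) =
      (\<Sum>i\<in>{0..<N} - X. bernoulli_avg ?A q (\<lambda>C. of_bool (\<not> sure_zero M C X i))) +
      (\<Sum>i\<in>X. bernoulli_avg ?A q (\<lambda>C. of_bool (\<not> sure_one N M C X i)))"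
    unfolding of_nat_add card_U0 card_U1 bernoulli_avg_add bernoulli_avg_sum ..
  then show ?thesis
    using X q finX
    by (simp add: prob_not_sure_zero prob_not_sure_one mean_undetermined_def card_Diff_subset)
qed

lemma bernoulli_avg_Tcost:
  assumes q: "0 \<le> q" "q \<le> 1"
  shows "bernoulli_avg ({0..<N} \<times> {0..<M}) q (\<lambda>C. Tcost N M C p) = real M + mean_second_stage N M q p"
proof -
  let ?A = "{0..<N} \<times> {0..<M}"
  let ?undetermined = "\<lambda>C X. real (card (U0 N M C X) + card (U1 N M C X))"
  have "Tcost N M C p = real M + bernoulli_avg {0..<N} p (?undetermined C)" for C
    unfolding Tcost_def bernoulli_avg_def mu_def by simp
  then have "bernoulli_avg ?A q (\<lambda>C. Tcost N M C p) =
      real M + bernoulli_avg {0..<N} p (\<lambda>X. bernoulli_avg ?A q (\<lambda>C. ?undetermined C X))"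
    by (simp add: bernoulli_avg_add bernoulli_avg_swap[of ?A])
  also have "bernoulli_avg {0..<N} p (\<lambda>X. bernoulli_avg ?A q (\<lambda>C. ?undetermined C X)) =
      bernoulli_avg {0..<N} p (\<lambda>X. mean_undetermined N M q (card X))"
    by (intro bernoulli_avg_cong bernoulli_avg_card_U0_U1 q)
  also have "\<dots> = mean_second_stage N M q p"
    using bernoulli_avg_card[of "{0..<N}" p "mean_undetermined N M q"] by (simp add: mean_second_stage_def)
  finally show ?thesis .
qed

lemma mean_second_stage_bounds:
  assumes q: "0 \<le> q" "q \<le> 1" and p: "0 \<le> p" "p \<le> 1"
  shows "0 \<le> mean_second_stage N M q p"
    and "mean_second_stage N M q p \<le> real N * binomial_avg N p (zero_miss_prob M q) + real N * p"
proof -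
  show "0 \<le> mean_second_stage N M q p"
    using binomial_avg_mono[OF p, of N "\<lambda>_. 0"] mean_undetermined_bounds(1)[OF q]
    by (simp add: mean_second_stage_def)
  have "mean_second_stage N M q p \<le> binomial_avg N p (\<lambda>k. real N * zero_miss_prob M q k + real k)"
    unfolding mean_second_stage_def by (intro binomial_avg_mono p mean_undetermined_bounds(2) q)
  then show "mean_second_stage N M q p \<le> real N * binomial_avg N p (zero_miss_prob M q) + real N * p"
    by (simp add: binomial_avg_add binomial_avg_cmult binomial_avg_mean)
qed

definition inclusion_prob :: "nat \<Rightarrow> real \<Rightarrow> real" where
  "inclusion_prob N p = real (Ltil p) / real (Mtil N p)"

lemma avg_cost_eq:
  assumes "inclusion_prob N p \<le> 1"
  shows "avg_cost N p =
    (real (Mtil N p) + mean_second_stage N (Mtil N p) (inclusion_prob N p) p) / (real N * p * \<bar>ln p\<bar>)"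
proof -
  let ?M = "Mtil N p" and ?q = "inclusion_prob N p"
  have "PP N ?M (Ltil p) C = (\<Prod>x\<in>{0..<N} \<times> {0..<?M}. if x \<in> C then ?q else 1 - ?q)" for C
    unfolding PP_def inclusion_prob_def by (subst prod.swap) (simp add: prod.cartesian_product)
  then have "avg_cost N p =
      bernoulli_avg ({0..<N} \<times> {0..<?M}) ?q (\<lambda>C. Tcost N ?M C p) / (real N * p * \<bar>ln p\<bar>)"
    by (simp add: avg_cost_def bernoulli_avg_def sum_divide_distrib)
  moreover have "0 \<le> ?q" by (simp add: inclusion_prob_def)
  ultimately show ?thesis
    using assms by (simp add: bernoulli_avg_Tcost)
qed

section \<open>An error bound uniform in N and p\<close>

lemma one_minus_power_le_exp:
  fixes q :: real
  assumes "q \<le> 1"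
  shows "(1 - q) ^ n \<le> exp (- (real n * q))"
proof -
  have "(1 - q) ^ n \<le> exp (- q) ^ n"
    using assms exp_ge_add_one_self[of "- q"] by (intro power_mono) auto
  then show ?thesis by (simp add: exp_of_nat_mult[symmetric])
qed

lemma exp_le_one_minus_powr:
  fixes q t :: real
  assumes "q < 1" "0 \<le> t"
  shows "exp (- (t * q / (1 - q))) \<le> (1 - q) powr t"
proof -
  have "ln 1 - ln (1 - q) \<le> (1 - (1 - q)) / (1 - q)"
    using assms by (intro ln_diff_le) auto
  then have "t * - (q / (1 - q)) \<le> t * ln (1 - q)"
    using assms(2) by (intro mult_left_mono) auto
  then show ?thesis using assms(1) by (simp add: powr_def)
qed

text \<open>
  Chebyshev's inequality for the tail would be too weak for \<open>p = N powr (- \<beta>)\<close> with \<open>\<beta> \<ge> 1/2\<close>.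
\<close>
lemma binomial_avg_zero_miss_prob_le:
  assumes p: "0 \<le> p" "p \<le> 1" and q: "0 \<le> q" "q < 1" and \<delta>: "0 \<le> \<delta>" "\<delta> \<le> 1"
  shows "binomial_avg N p (zero_miss_prob M q) \<le>
    exp (- (real M * q * (1 - q) powr ((1 + \<delta>) * (real N * p)))) + exp (- (\<delta>\<^sup>2 * (real N * p) / 4))"
proof -
  let ?t = "(1 + \<delta>) * (real N * p)"
  let ?typical = "exp (- (real M * q * (1 - q) powr ?t))"
  have "binomial_avg N p (zero_miss_prob M q) \<le> binomial_avg N p (\<lambda>k. ?typical + of_bool (?t < real k))"
  proof (rule binomial_avg_mono[OF p])
    fix k
    show "zero_miss_prob M q k \<le> ?typical + of_bool (?t < real k)"
    proof (cases "?t < real k")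
      case True
      have "zero_miss_prob M q k \<le> 1" using zero_miss_prob_bounds[of q M k] q by auto
      then show ?thesis using True by (simp add: add_increasing)
    next
      case False
      have "q * (1 - q) ^ k \<le> 1"
        using q by (intro mult_le_one) (auto simp: power_le_one)
      then have "zero_miss_prob M q k \<le> exp (- (real M * (q * (1 - q) ^ k)))"
        unfolding zero_miss_prob_def by (rule one_minus_power_le_exp)
      also have "(1 - q) ^ k = (1 - q) powr real k"
        using q by (simp add: powr_realpow)
      also have "exp (- (real M * (q * (1 - q) powr real k))) \<le> ?typical"
        using False q by (simp add: mult_left_mono powr_mono' mult.assoc)
      finally show ?thesis using False by simp
    qed
  qed
  also have "\<dots> = ?typical + binomial_avg N p (\<lambda>k. of_bool (?t < real k))"
    by (simp add: binomial_avg_add)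
  also have "\<dots> \<le> ?typical + exp (- (\<delta>\<^sup>2 * (real N * p) / 4))"
    by (intro add_left_mono binomial_avg_chernoff p \<delta>)
  finally show ?thesis .
qed

lemma Ltil_bounds:
  shows "real (Ltil p) \<le> exp 1 * \<bar>ln p\<bar>"
    and "exp 1 * \<bar>ln p\<bar> - 1 \<le> real (Ltil p)"
proof -
  have "0 \<le> exp 1 * \<bar>ln p\<bar>" by simp
  then show "real (Ltil p) \<le> exp 1 * \<bar>ln p\<bar>" "exp 1 * \<bar>ln p\<bar> - 1 \<le> real (Ltil p)"
    unfolding Ltil_def by linarith+
qed

lemma Mtil_bounds:
  assumes "0 \<le> p"
  shows "real (Mtil N p) \<le> exp 1 * real N * p * \<bar>ln p\<bar>"
    and "exp 1 * real N * p * \<bar>ln p\<bar> - 1 \<le> real (Mtil N p)"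
proof -
  have "0 \<le> exp 1 * real N * p * \<bar>ln p\<bar>" using assms by simp
  then show "real (Mtil N p) \<le> exp 1 * real N * p * \<bar>ln p\<bar>"
    "exp 1 * real N * p * \<bar>ln p\<bar> - 1 \<le> real (Mtil N p)"
    unfolding Mtil_def by linarith+
qed

lemma
  fixes p :: real
  assumes "0 < p" "p \<le> exp (- 1)"
  shows abs_ln_ge_1: "1 \<le> \<bar>ln p\<bar>"
    and exp_minus_abs_ln: "exp (- \<bar>ln p\<bar>) = p"
    and less_1_if_le_exp_minus_1: "p < 1"
proof -
  have "ln p \<le> - 1" using ln_mono[OF assms(2,1)] by simp
  then have "1 \<le> \<bar>ln p\<bar> \<and> \<bar>ln p\<bar> = - ln p" by linarith
  then show "1 \<le> \<bar>ln p\<bar>" "exp (- \<bar>ln p\<bar>) = p" using assms(1) by auto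
  have "exp (- 1 :: real) < 1" by simp
  with assms(2) show "p < 1" by linarith
qed

text \<open>
  The lower bound on \<open>N p\<close> makes the Chernoff term \<open>exp (- \<delta>\<^sup>2 N p / 4)\<close> at most \<open>p\<close> for \<open>\<delta> = 1 / |ln p|\<close>;
  this \<open>\<delta>\<close> is small enough to change the exponent \<open>L / e \<approx> |ln p|\<close> by a bounded amount only.
\<close>
context
  fixes N :: nat and p :: real
  assumes p: "0 < p" "p \<le> exp (- 1)" and N: "4 * \<bar>ln p\<bar> ^ 3 \<le> real N * p"
begin

lemma four_abs_ln_le: "4 * \<bar>ln p\<bar> \<le> real N * p"
  using N power_increasing[of 1 3 "\<bar>ln p\<bar>"] abs_ln_ge_1[OF p] by simp

lemma Ltil_less_Mtil: "Ltil p < Mtil N p"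
proof -
  have "4 \<le> real N * p"
    using four_abs_ln_le abs_ln_ge_1[OF p] by linarith
  moreover have "1 \<le> exp 1 * \<bar>ln p\<bar>"
    using mult_mono[of 1 "exp 1" 1 "\<bar>ln p\<bar>"] abs_ln_ge_1[OF p] by simp
  ultimately have "1 * (4 - 1) \<le> (exp 1 * \<bar>ln p\<bar>) * (real N * p - 1)"
    by (intro mult_mono) auto
  then have "exp 1 * \<bar>ln p\<bar> < exp 1 * real N * p * \<bar>ln p\<bar> - 1"
    by (simp add: algebra_simps)
  then show ?thesis
    using Ltil_bounds(1)[of p] Mtil_bounds(2)[of p N] p by linarith
qed

lemma inclusion_prob_less_1: "inclusion_prob N p < 1"
  and Mtil_mult_inclusion_prob: "real (Mtil N p) * inclusion_prob N p = real (Ltil p)"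
  using Ltil_less_Mtil by (auto simp: inclusion_prob_def)

lemma inclusion_odds_le:
  "(1 + 1 / \<bar>ln p\<bar>) * (real N * p) * inclusion_prob N p / (1 - inclusion_prob N p) \<le> 1 + 3 / \<bar>ln p\<bar>"
proof -
  define l where "l = \<bar>ln p\<bar>"
  define n where "n = real N * p"
  let ?L = "real (Ltil p)" and ?M = "real (Mtil N p)"
  have l_ge_1: "1 \<le> l" and n_ge: "4 * l \<le> n"
    using abs_ln_ge_1[OF p] four_abs_ln_le by (simp_all add: l_def n_def)
  have L_le: "?L \<le> exp 1 * l" and M_ge: "exp 1 * n * l - 1 \<le> ?M"
    using Ltil_bounds(1) Mtil_bounds(2)[of p N] p by (auto simp: l_def n_def mult.assoc)
  have "1 \<le> exp 1 * l"
    using mult_mono[of 1 "exp 1" 1 l] l_ge_1 by simp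
  then have "(l + 3) * (1 + exp 1 * l) \<le> (4 * l) * (2 * (exp 1 * l))"
    using l_ge_1 by (intro mult_mono) linarith+
  also have "\<dots> \<le> n * (2 * (exp 1 * l))"
    using n_ge l_ge_1 by (intro mult_right_mono) auto
  finally have "(l + 1) * n * (exp 1 * l) \<le> (l + 3) * ((exp 1 * n * l - 1) - exp 1 * l)"
    by (simp add: algebra_simps)
  moreover have "(l + 1) * n * ?L \<le> (l + 1) * n * (exp 1 * l)"
    using l_ge_1 n_ge L_le by (intro mult_left_mono) auto
  moreover have "(l + 3) * ((exp 1 * n * l - 1) - exp 1 * l) \<le> (l + 3) * (?M - ?L)"
    using l_ge_1 L_le M_ge by (intro mult_left_mono) auto
  ultimately have "(l + 1) * n * ?L \<le> (l + 3) * (?M - ?L)" by linarith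
  then have "(l + 1) * n * ?L / (l * (?M - ?L)) \<le> (l + 3) * (?M - ?L) / (l * (?M - ?L))"
    using Ltil_less_Mtil l_ge_1 by (intro divide_right_mono) auto
  moreover have "(l + 3) * (?M - ?L) / (l * (?M - ?L)) = 1 + 3 / l"
    using Ltil_less_Mtil l_ge_1 by (simp add: field_simps)
  moreover have "(1 + 1 / l) * n * (?L / ?M) / (1 - ?L / ?M) = (l + 1) * n * ?L / (l * (?M - ?L))"
    using Ltil_less_Mtil l_ge_1 by (simp add: field_simps)
  ultimately show ?thesis by (simp add: l_def n_def inclusion_prob_def)
qed

text \<open>
  The right-hand side is the mean number of negative tests containing a given zero when there are
  \<open>(1 + 1 / |ln p|) N p\<close> ones.
\<close>
lemma expected_negative_tests_ge:
  "\<bar>ln p\<bar> - 4 \<le> real (Ltil p) * (1 - inclusion_prob N p) powr ((1 + 1 / \<bar>ln p\<bar>) * (real N * p))"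
proof -
  define l where "l = \<bar>ln p\<bar>"
  let ?q = "inclusion_prob N p" and ?t = "(1 + 1 / l) * (real N * p)"
  have l_ge_1: "1 \<le> l" using abs_ln_ge_1[OF p] by (simp add: l_def)
  have "exp (- (1 + 3 / l)) \<le> exp (- (?t * ?q / (1 - ?q)))"
    using inclusion_odds_le by (simp add: l_def)
  also have "\<dots> \<le> (1 - ?q) powr ?t"
    using l_ge_1 p inclusion_prob_less_1 by (intro exp_le_one_minus_powr) auto
  finally have avoid: "exp (- (1 + 3 / l)) \<le> (1 - ?q) powr ?t" .
  have "(l - exp (- 1)) * (1 - 3 / l) = l - 3 - exp (- 1) + 3 * exp (- 1) / l"
    using l_ge_1 by (simp add: field_simps)
  moreover have "exp (- 1 :: real) \<le> 1" "0 \<le> 3 * exp (- 1) / l" using l_ge_1 by auto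
  ultimately have "l - 4 \<le> (l - exp (- 1)) * (1 - 3 / l)" by linarith
  also have "\<dots> \<le> (l - exp (- 1)) * exp (- (3 / l))"
    using l_ge_1 exp_ge_add_one_self[of "- (3 / l)"]
    by (intro mult_left_mono) (auto intro: order.trans[of _ 1])
  also have "\<dots> = (exp 1 * l - 1) * exp (- (1 + 3 / l))"
    by (simp add: exp_add exp_minus exp_diff field_simps)
  also have "\<dots> \<le> real (Ltil p) * (1 - ?q) powr ?t"
    using avoid Ltil_bounds(2)[of p] by (intro mult_mono) (auto simp: l_def)
  finally show ?thesis by (simp add: l_def)
qed

lemma avg_zero_miss_prob_le:
  "binomial_avg N p (zero_miss_prob (Mtil N p) (inclusion_prob N p)) \<le> (exp 4 + 1) * p"
proof -
  define l where "l = \<bar>ln p\<bar>"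
  let ?M = "Mtil N p" and ?q = "inclusion_prob N p"
  let ?t = "(1 + 1 / l) * (real N * p)"
  have l_ge_1: "1 \<le> l" and exp_minus_l: "exp (- l) = p"
    using abs_ln_ge_1[OF p] exp_minus_abs_ln[OF p] by (auto simp: l_def)
  have "exp (- (real ?M * ?q * (1 - ?q) powr ?t)) \<le> exp (4 - l)"
    using expected_negative_tests_ge by (simp add: l_def Mtil_mult_inclusion_prob)
  also have "\<dots> = exp 4 * p"
    using exp_minus_l by (simp add: exp_diff exp_minus divide_inverse)
  finally have typical: "exp (- (real ?M * ?q * (1 - ?q) powr ?t)) \<le> exp 4 * p" .
  have "l \<le> (1 / l)\<^sup>2 * (real N * p) / 4"
    using N l_ge_1 by (simp add: l_def[symmetric] field_simps power2_eq_square power3_eq_cube)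
  then have "exp (- ((1 / l)\<^sup>2 * (real N * p) / 4)) \<le> exp (- l)" by simp
  then have tail: "exp (- ((1 / l)\<^sup>2 * (real N * p) / 4)) \<le> p" using exp_minus_l by simp
  have "p \<le> 1" using less_1_if_le_exp_minus_1[OF p] by simp
  then have "binomial_avg N p (zero_miss_prob ?M ?q) \<le>
      exp (- (real ?M * ?q * (1 - ?q) powr ?t)) + exp (- ((1 / l)\<^sup>2 * (real N * p) / 4))"
    using p l_ge_1 inclusion_prob_less_1
    by (intro binomial_avg_zero_miss_prob_le) (auto simp: inclusion_prob_def)
  also have "\<dots> \<le> (exp 4 + 1) * p"
    using add_mono[OF typical tail] by (simp add: distrib_right)
  finally show ?thesis .
qed

lemma abs_avg_cost_diff_le: "\<bar>avg_cost N p - exp 1\<bar> \<le> (exp 4 + 2) / \<bar>ln p\<bar>"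
proof -
  define l where "l = \<bar>ln p\<bar>"
  define n where "n = real N * p"
  let ?M = "Mtil N p" and ?q = "inclusion_prob N p"
  have "p < 1" by (rule less_1_if_le_exp_minus_1[OF p])
  have l_ge_1: "1 \<le> l" using abs_ln_ge_1[OF p] by (simp add: l_def)
  have n_ge: "1 \<le> n" using four_abs_ln_le l_ge_1 by (simp add: l_def n_def)
  have q: "0 \<le> ?q" "?q \<le> 1" using inclusion_prob_less_1 by (auto simp: inclusion_prob_def)
  have cost: "avg_cost N p = real ?M / (n * l) + mean_second_stage N ?M ?q p / (n * l)"
    using q by (simp add: avg_cost_eq n_def l_def add_divide_distrib)
  have M_bounds: "real ?M \<le> exp 1 * (n * l)" "exp 1 * (n * l) - 1 \<le> real ?M"
    using Mtil_bounds[of p N] p by (auto simp: n_def l_def mult.assoc)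
  have first_stage: "real ?M / (n * l) \<le> exp 1" "exp 1 - 1 / (n * l) \<le> real ?M / (n * l)"
    using divide_right_mono[OF M_bounds(1), of "n * l"] divide_right_mono[OF M_bounds(2), of "n * l"]
      n_ge l_ge_1
    by (simp_all add: diff_divide_distrib)
  have "mean_second_stage N ?M ?q p \<le> real N * binomial_avg N p (zero_miss_prob ?M ?q) + real N * p"
    using p \<open>p < 1\<close> by (intro mean_second_stage_bounds(2) q) auto
  also have "\<dots> \<le> real N * ((exp 4 + 1) * p) + real N * p"
    by (intro add_right_mono mult_left_mono avg_zero_miss_prob_le) simp
  finally have "mean_second_stage N ?M ?q p / (n * l) \<le> (exp 4 + 2) * n / (n * l)"
    using n_ge l_ge_1 by (intro divide_right_mono) (auto simp: n_def algebra_simps)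
  then have "mean_second_stage N ?M ?q p / (n * l) \<le> (exp 4 + 2) / l"
    using n_ge by simp
  moreover have "0 \<le> mean_second_stage N ?M ?q p / (n * l)"
    using mean_second_stage_bounds(1)[OF q] p \<open>p < 1\<close> n_ge l_ge_1 by simp
  moreover have "1 / (n * l) \<le> (exp 4 + 2) / l"
    using n_ge l_ge_1 by (intro frac_le) (auto intro: order.trans[of _ 2] simp: mult_left_le)
  ultimately show ?thesis
    using first_stage unfolding cost l_def[symmetric] abs_le_iff by linarith
qed

end

section \<open>Convergence for fixed p\<close>

lemma one_minus_power_tendsto_exp:
  fixes q :: "'a \<Rightarrow> real" and n :: "'a \<Rightarrow> nat"
  assumes q: "(q \<longlongrightarrow> 0) F"
    and nq: "((\<lambda>a. real (n a) * q a) \<longlongrightarrow> z) F"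
  shows "((\<lambda>a. (1 - q a) ^ n a) \<longlongrightarrow> exp (- z)) F"
proof (rule real_tendsto_sandwich)
  have "\<forall>\<^sub>F a in F. q a < 1" using order_tendstoD(2)[OF q] by simp
  then show "\<forall>\<^sub>F a in F. exp (- (real (n a) * q a / (1 - q a))) \<le> (1 - q a) ^ n a"
    by eventually_elim (use exp_le_one_minus_powr in \<open>simp add: powr_realpow[symmetric]\<close>)
  show "\<forall>\<^sub>F a in F. (1 - q a) ^ n a \<le> exp (- (real (n a) * q a))"
    using \<open>\<forall>\<^sub>F a in F. q a < 1\<close> by eventually_elim (simp add: one_minus_power_le_exp)
  have "((\<lambda>a. exp (- (real (n a) * q a / (1 - q a)))) \<longlongrightarrow> exp (- (z / (1 - 0)))) F"
    by (intro tendsto_intros nq q) simp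
  then show "((\<lambda>a. exp (- (real (n a) * q a / (1 - q a)))) \<longlongrightarrow> exp (- z)) F" by simp
  show "((\<lambda>a. exp (- (real (n a) * q a))) \<longlongrightarrow> exp (- z)) F"
    by (intro tendsto_intros nq)
qed

lemma tendsto_rescale:
  fixes j m :: "'a \<Rightarrow> nat" and q :: "'a \<Rightarrow> real"
  assumes "((\<lambda>a. real (j a) / real (m a)) \<longlongrightarrow> y) F" "((\<lambda>a. real (m a) * q a) \<longlongrightarrow> c) F"
    and "filterlim m at_top F"
  shows "((\<lambda>a. real (j a) * q a) \<longlongrightarrow> y * c) F"
proof (rule Lim_transform_eventually)
  show "((\<lambda>a. real (j a) / real (m a) * (real (m a) * q a)) \<longlongrightarrow> y * c) F"
    by (intro tendsto_mult assms)
  have "\<forall>\<^sub>F a in F. m a > 0"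
    using assms(3) eventually_compose_filterlim eventually_gt_at_top by blast
  then show "\<forall>\<^sub>F a in F. real (j a) / real (m a) * (real (m a) * q a) = real (j a) * q a"
    by eventually_elim simp
qed

lemma tendsto_ratio_diff:
  fixes j m :: "'a \<Rightarrow> nat"
  assumes "((\<lambda>a. real (j a) / real (m a)) \<longlongrightarrow> y) F" "y < 1" "filterlim m at_top F"
  shows "((\<lambda>a. real (m a - j a) / real (m a)) \<longlongrightarrow> 1 - y) F"
proof (rule Lim_transform_eventually)
  show "((\<lambda>a. 1 - real (j a) / real (m a)) \<longlongrightarrow> 1 - y) F"
    by (intro tendsto_intros assms)
  have "\<forall>\<^sub>F a in F. m a > 0"
    using assms(3) eventually_compose_filterlim eventually_gt_at_top by blast
  moreover have "\<forall>\<^sub>F a in F. real (j a) / real (m a) < 1"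
    by (rule order_tendstoD(2)[OF assms(1,2)])
  ultimately show "\<forall>\<^sub>F a in F. 1 - real (j a) / real (m a) = real (m a - j a) / real (m a)"
    by eventually_elim (simp add: of_nat_diff field_simps)
qed

text \<open>
  \<open>\<kappa>\<close> is the limiting mean number of variables per test, \<open>\<Lambda>\<close> that of tests per variable.
\<close>
locale sparse_designs =
  fixes F :: "'a filter" and N M :: "'a \<Rightarrow> nat" and q :: "'a \<Rightarrow> real" and \<kappa> \<Lambda> :: real
  assumes N: "filterlim N at_top F" and M: "filterlim M at_top F"
    and q_nonneg: "\<And>a. 0 \<le> q a"
    and Nq: "((\<lambda>a. real (N a) * q a) \<longlongrightarrow> \<kappa>) F" and Mq: "((\<lambda>a. real (M a) * q a) \<longlongrightarrow> \<Lambda>) F"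
begin

lemma sparse_designs_ratio_filter:
  "sparse_designs (ratio_filter F m y) (\<lambda>z. N (fst z)) (\<lambda>z. M (fst z)) (\<lambda>z. q (fst z)) \<kappa> \<Lambda>"
  by unfold_locales
    (auto intro!: q_nonneg filterlim_compose[OF N] filterlim_compose[OF M] filterlim_compose[OF Nq]
      filterlim_compose[OF Mq] filterlim_fst_ratio_filter)

lemma eventually_N_pos: "\<forall>\<^sub>F a in F. N a > 0"
  using N eventually_compose_filterlim eventually_gt_at_top by blast

lemma q_tendsto_0: "(q \<longlongrightarrow> 0) F"
proof (rule Lim_transform_eventually)
  show "((\<lambda>a. real (N a) * q a / real (N a)) \<longlongrightarrow> 0) F"
    by (intro tendsto_divide_0[OF Nq] filterlim_at_top_imp_at_infinity
        filterlim_compose[OF filterlim_real_sequentially N])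
  show "\<forall>\<^sub>F a in F. real (N a) * q a / real (N a) = q a"
    using eventually_N_pos by eventually_elim simp
qed

lemma eventually_q_le_1: "\<forall>\<^sub>F a in F. q a \<le> 1"
  using order_tendstoD(2)[OF q_tendsto_0, of 1] by (auto elim: eventually_mono)

lemma power_tendsto_exp:
  assumes "((\<lambda>a. real (j a) * q a) \<longlongrightarrow> z) F"
  shows "((\<lambda>a. (1 - q a) ^ j a) \<longlongrightarrow> exp (- z)) F"
  using assms by (intro one_minus_power_tendsto_exp q_tendsto_0)

lemma zero_miss_prob_tendsto:
  assumes "((\<lambda>a. real (k a) / real (N a)) \<longlongrightarrow> p) F"
  shows "((\<lambda>a. zero_miss_prob (M a) (q a) (k a)) \<longlongrightarrow> exp (- (exp (- (p * \<kappa>)) * \<Lambda>))) F"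
  unfolding zero_miss_prob_def
proof (rule one_minus_power_tendsto_exp)
  have avoid: "((\<lambda>a. (1 - q a) ^ k a) \<longlongrightarrow> exp (- (p * \<kappa>))) F"
    by (intro power_tendsto_exp tendsto_rescale[OF assms Nq N])
  show "((\<lambda>a. q a * (1 - q a) ^ k a) \<longlongrightarrow> 0) F"
    using tendsto_mult[OF q_tendsto_0 avoid] by simp
  show "((\<lambda>a. real (M a) * (q a * (1 - q a) ^ k a)) \<longlongrightarrow> exp (- (p * \<kappa>)) * \<Lambda>) F"
    using tendsto_mult[OF Mq avoid] by (simp add: mult_ac)
qed

lemma detection_prob_ratio_tendsto:
  assumes k: "((\<lambda>a. real (k a) / real (N a)) \<longlongrightarrow> p) F" and "0 < p" "0 < \<kappa>"
    and w: "((\<lambda>a. real (w a) / real (N a)) \<longlongrightarrow> \<omega>) F"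
  shows "((\<lambda>a. (1 - q a) ^ (k a - 1 + w a) / (1 - (1 - q a) ^ k a))
    \<longlongrightarrow> exp (- ((p + \<omega>) * \<kappa>)) / (1 - exp (- (p * \<kappa>)))) F"
proof (intro tendsto_divide tendsto_diff tendsto_const)
  have "\<forall>\<^sub>F a in F. 0 < real (k a) / real (N a)"
    by (rule order_tendstoD(1)[OF k \<open>0 < p\<close>])
  then have "\<forall>\<^sub>F a in F. real (k a) * q a + real (w a) * q a - q a = real (k a - 1 + w a) * q a"
    by eventually_elim (auto simp: zero_less_divide_iff of_nat_diff algebra_simps)
  moreover have "((\<lambda>a. real (k a) * q a + real (w a) * q a - q a) \<longlongrightarrow> p * \<kappa> + \<omega> * \<kappa> - 0) F"
    by (intro tendsto_intros tendsto_rescale[OF _ Nq N] k w q_tendsto_0)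
  ultimately show "((\<lambda>a. (1 - q a) ^ (k a - 1 + w a)) \<longlongrightarrow> exp (- ((p + \<omega>) * \<kappa>))) F"
    by (intro power_tendsto_exp) (auto simp: distrib_right elim: Lim_transform_eventually)
  show "((\<lambda>a. (1 - q a) ^ k a) \<longlongrightarrow> exp (- (p * \<kappa>))) F"
    by (intro power_tendsto_exp tendsto_rescale[OF k Nq N])
qed (use assms in simp)

lemma positive_tests_undetecting_tendsto:
  assumes k: "((\<lambda>a. real (k a) / real (N a)) \<longlongrightarrow> p) F" and pos: "0 < p" "0 < \<kappa>"
    and r: "((\<lambda>a. real (r a) / real (M a)) \<longlongrightarrow> exp (- (p * \<kappa>))) F"
    and w: "((\<lambda>a. real (w a) / real (N a)) \<longlongrightarrow> \<omega>) F"
  shows "((\<lambda>a. (1 - detection_prob (q a) (k a) (w a)) ^ (M a - r a))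
    \<longlongrightarrow> exp (- (\<Lambda> * exp (- ((p + \<omega>) * \<kappa>))))) F"
proof (rule one_minus_power_tendsto_exp)
  have avoid: "exp (- (p * \<kappa>)) < 1" using pos by simp
  note ratio = detection_prob_ratio_tendsto[OF k pos w]
  show "((\<lambda>a. detection_prob (q a) (k a) (w a)) \<longlongrightarrow> 0) F"
    unfolding detection_prob_def using tendsto_mult[OF q_tendsto_0 ratio] by simp
  have "((\<lambda>a. real (M a - r a) * q a) \<longlongrightarrow> (1 - exp (- (p * \<kappa>))) * \<Lambda>) F"
    by (intro tendsto_rescale[OF _ Mq M] tendsto_ratio_diff[OF r avoid M])
  from tendsto_mult[OF this ratio]
  show "((\<lambda>a. real (M a - r a) * detection_prob (q a) (k a) (w a)) \<longlongrightarrow> \<Lambda> * exp (- ((p + \<omega>) * \<kappa>))) F"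
    unfolding detection_prob_def using pos by (simp add: mult.assoc)
qed

lemma undetected_one_avg_tendsto:
  assumes k: "((\<lambda>a. real (k a) / real (N a)) \<longlongrightarrow> p) F" and p: "0 < p" "p < 1" and "0 < \<kappa>"
    and r: "((\<lambda>a. real (r a) / real (M a)) \<longlongrightarrow> exp (- (p * \<kappa>))) F"
  defines "\<omega> \<equiv> (1 - p) * exp (- (exp (- (p * \<kappa>)) * \<Lambda>))"
  shows "((\<lambda>a. binomial_avg (N a - k a) ((1 - q a) ^ r a)
      (\<lambda>w. (1 - detection_prob (q a) (k a) w) ^ (M a - r a)))
    \<longlongrightarrow> exp (- (\<Lambda> * exp (- ((p + \<omega>) * \<kappa>))))) F"
proof (rule binomial_avg_tendsto[where m = N and y = \<omega> and B = 1])
  let ?G = "ratio_filter F N \<omega>"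
  interpret G: sparse_designs ?G "\<lambda>z. N (fst z)" "\<lambda>z. M (fst z)" "\<lambda>z. q (fst z)" \<kappa> \<Lambda>
    by (rule sparse_designs_ratio_filter)
  show "((\<lambda>z. (1 - detection_prob (q (fst z)) (k (fst z)) (snd z))
      ^ (M (fst z) - r (fst z))) \<longlongrightarrow> exp (- (\<Lambda> * exp (- ((p + \<omega>) * \<kappa>))))) ?G"
    using p \<open>0 < \<kappa>\<close> filterlim_compose[OF k filterlim_fst_ratio_filter]
      filterlim_compose[OF r filterlim_fst_ratio_filter] tendsto_ratio_filter
    by (intro G.positive_tests_undetecting_tendsto)
  show "\<forall>\<^sub>F a in F. 0 \<le> (1 - q a) ^ r a \<and> (1 - q a) ^ r a \<le> 1"
    using eventually_q_le_1 by eventually_elim (auto simp: q_nonneg power_le_one)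
  have "((\<lambda>a. real (N a - k a) / real (N a) * (1 - q a) ^ r a) \<longlongrightarrow> \<omega>) F"
    unfolding \<omega>_def
    by (intro tendsto_mult tendsto_ratio_diff[OF k p(2) N] power_tendsto_exp tendsto_rescale[OF r Mq M])
  then show "((\<lambda>a. real (N a - k a) * (1 - q a) ^ r a / real (N a)) \<longlongrightarrow> \<omega>) F"
    by simp
  show "\<forall>\<^sub>F a in F. \<forall>w\<le>N a - k a.
      \<bar>(1 - detection_prob (q a) (k a) w) ^ (M a - r a)\<bar> \<le> 1"
    using eventually_q_le_1
    by eventually_elim (use detection_prob_bounds q_nonneg in \<open>auto simp: power_abs power_le_one\<close>)
qed (auto simp: N)

lemma one_miss_prob_tendsto:
  assumes k: "((\<lambda>a. real (k a) / real (N a)) \<longlongrightarrow> p) F" and p: "0 < p" "p < 1" and "0 < \<kappa>"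
  defines "\<omega> \<equiv> (1 - p) * exp (- (exp (- (p * \<kappa>)) * \<Lambda>))"
  shows "((\<lambda>a. one_miss_prob (N a) (M a) (q a) (k a)) \<longlongrightarrow> exp (- (\<Lambda> * exp (- ((p + \<omega>) * \<kappa>))))) F"
  unfolding one_miss_prob_def
proof (rule binomial_avg_tendsto[where m = M and y = "exp (- (p * \<kappa>))" and B = 1])
  let ?G = "ratio_filter F M (exp (- (p * \<kappa>)))"
  interpret G: sparse_designs ?G "\<lambda>z. N (fst z)" "\<lambda>z. M (fst z)" "\<lambda>z. q (fst z)" \<kappa> \<Lambda>
    by (rule sparse_designs_ratio_filter)
  show "((\<lambda>z. binomial_avg (N (fst z) - k (fst z)) ((1 - q (fst z)) ^ snd z)
      (\<lambda>w. (1 - detection_prob (q (fst z)) (k (fst z)) w)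
        ^ (M (fst z) - snd z))) \<longlongrightarrow> exp (- (\<Lambda> * exp (- ((p + \<omega>) * \<kappa>))))) ?G"
    unfolding \<omega>_def
    using p \<open>0 < \<kappa>\<close> filterlim_compose[OF k filterlim_fst_ratio_filter] tendsto_ratio_filter
    by (intro G.undetected_one_avg_tendsto)
  show "\<forall>\<^sub>F a in F. 0 \<le> (1 - q a) ^ k a \<and> (1 - q a) ^ k a \<le> 1"
    using eventually_q_le_1 by eventually_elim (auto simp: q_nonneg power_le_one)
  have "\<forall>\<^sub>F a in F. M a > 0"
    using M eventually_compose_filterlim eventually_gt_at_top by blast
  then have "\<forall>\<^sub>F a in F. (1 - q a) ^ k a = real (M a) * (1 - q a) ^ k a / real (M a)"
    by eventually_elim simp
  moreover have "((\<lambda>a. (1 - q a) ^ k a) \<longlongrightarrow> exp (- (p * \<kappa>))) F"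
    by (intro power_tendsto_exp tendsto_rescale[OF k Nq N])
  ultimately show "((\<lambda>a. real (M a) * (1 - q a) ^ k a / real (M a)) \<longlongrightarrow> exp (- (p * \<kappa>))) F"
    by (rule Lim_transform_eventually[rotated])
  show "\<forall>\<^sub>F a in F. \<forall>r\<le>M a. \<bar>binomial_avg (N a - k a) ((1 - q a) ^ r)
      (\<lambda>w. (1 - detection_prob (q a) (k a) w) ^ (M a - r))\<bar> \<le> 1"
    using eventually_q_le_1
  proof eventually_elim
    case (elim a)
    have "binomial_avg (N a - k a) ((1 - q a) ^ r)
      (\<lambda>w. (1 - detection_prob (q a) (k a) w) ^ (M a - r)) \<in> {0..1}" for r
      using detection_prob_bounds[OF q_nonneg elim] q_nonneg elim
      by (intro binomial_avg_bounds) (auto simp: power_le_one)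
    then show ?case by auto
  qed
qed (auto simp: M)

lemma mean_undetermined_tendsto:
  assumes k: "((\<lambda>a. real (k a) / real (N a)) \<longlongrightarrow> p) F" and p: "0 < p" "p < 1" and "0 < \<kappa>"
  defines "\<zeta> \<equiv> exp (- (exp (- (p * \<kappa>)) * \<Lambda>))"
  shows "((\<lambda>a. mean_undetermined (N a) (M a) (q a) (k a) / real (N a))
    \<longlongrightarrow> (1 - p) * \<zeta> + p * exp (- (\<Lambda> * exp (- ((p + (1 - p) * \<zeta>) * \<kappa>))))) F"
proof -
  have "((\<lambda>a. real (N a - k a) / real (N a) * zero_miss_prob (M a) (q a) (k a) +
      real (k a) / real (N a) * one_miss_prob (N a) (M a) (q a) (k a))
    \<longlongrightarrow> (1 - p) * \<zeta> + p * exp (- (\<Lambda> * exp (- ((p + (1 - p) * \<zeta>) * \<kappa>))))) F"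
    unfolding \<zeta>_def using k p \<open>0 < \<kappa>\<close>
    by (intro tendsto_add tendsto_mult tendsto_ratio_diff zero_miss_prob_tendsto one_miss_prob_tendsto N)
  then show ?thesis
    by (simp add: mean_undetermined_def add_divide_distrib)
qed

lemma mean_second_stage_converges:
  assumes p: "0 < p" "p < 1" and "0 < \<kappa>"
  obtains l where "((\<lambda>a. mean_second_stage (N a) (M a) (q a) p / real (N a)) \<longlongrightarrow> l) F"
proof -
  let ?G = "ratio_filter F N p"
  let ?f = "\<lambda>a k. mean_undetermined (N a) (M a) (q a) k / real (N a)"
  interpret G: sparse_designs ?G "\<lambda>z. N (fst z)" "\<lambda>z. M (fst z)" "\<lambda>z. q (fst z)" \<kappa> \<Lambda>
    by (rule sparse_designs_ratio_filter)
  note integrand_tendsto = G.mean_undetermined_tendsto[OF tendsto_ratio_filter p \<open>0 < \<kappa>\<close>]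
  have "\<forall>\<^sub>F a in F. p = real (N a) * p / real (N a)"
    using eventually_N_pos by eventually_elim simp
  then have mean: "((\<lambda>a. real (N a) * p / real (N a)) \<longlongrightarrow> p) F"
    by (rule Lim_transform_eventually[OF tendsto_const])
  have bound: "\<forall>\<^sub>F a in F. \<forall>k\<le>N a. \<bar>?f a k\<bar> \<le> 1"
    using eventually_q_le_1 eventually_N_pos
    by eventually_elim (use mean_undetermined_bounds(1,3) q_nonneg in \<open>auto simp: divide_le_eq\<close>)
  show ?thesis
    using binomial_avg_tendsto[OF _ N _ mean bound integrand_tendsto] p that
    unfolding mean_second_stage_def binomial_avg_divide by simp
qed

end

lemma Mtil_ratio_tendsto:
  assumes "0 \<le> p"
  shows "(\<lambda>N. real (Mtil N p) / real N) \<longlonglongrightarrow> exp 1 * p * \<bar>ln p\<bar>"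
proof (rule real_tendsto_sandwich)
  let ?c = "exp 1 * p * \<bar>ln p\<bar>"
  show "(\<lambda>N. ?c - 1 / real N) \<longlonglongrightarrow> ?c" by real_asymp
  have M: "real (Mtil N p) \<le> ?c * real N" "?c * real N - 1 \<le> real (Mtil N p)" for N
    using Mtil_bounds[OF assms, of N] by (simp_all add: mult_ac)
  show "\<forall>\<^sub>F N in sequentially. ?c - 1 / real N \<le> real (Mtil N p) / real N"
    using eventually_gt_at_top[of 0]
  proof eventually_elim
    case (elim N)
    then show ?case
      using divide_right_mono[OF M(2)[of N], of "real N"] by (simp add: diff_divide_distrib)
  qed
  show "\<forall>\<^sub>F N in sequentially. real (Mtil N p) / real N \<le> ?c"
    using eventually_gt_at_top[of 0] by eventually_elim (use M(1) in \<open>simp add: divide_le_eq\<close>)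
qed simp

lemma filterlim_Mtil:
  assumes "0 < p" "p < 1"
  shows "filterlim (\<lambda>N. Mtil N p) at_top sequentially"
  unfolding filterlim_sequentially_iff_filterlim_real
proof (rule filterlim_at_top_mono)
  have "0 < exp 1 * p * \<bar>ln p\<bar>" using assms by (intro mult_pos_pos) auto
  then show "filterlim (\<lambda>N. exp 1 * p * \<bar>ln p\<bar> * real N - 1) at_top sequentially" by real_asymp
  show "\<forall>\<^sub>F N in sequentially. exp 1 * p * \<bar>ln p\<bar> * real N - 1 \<le> real (Mtil N p)"
    using Mtil_bounds(2)[of p] assms by (simp add: mult_ac)
qed

lemma sparse_designs_inclusion_prob:
  assumes p: "0 < p" "p < 1"
  shows "sparse_designs sequentially (\<lambda>N. N) (\<lambda>N. Mtil N p) (\<lambda>N. inclusion_prob N p)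
    (real (Ltil p) / (exp 1 * p * \<bar>ln p\<bar>)) (real (Ltil p))"
proof
  show "filterlim (\<lambda>N. Mtil N p) at_top sequentially" by (rule filterlim_Mtil[OF p])
  then have "\<forall>\<^sub>F N in sequentially. Mtil N p > 0"
    using eventually_compose_filterlim eventually_gt_at_top by blast
  then have "\<forall>\<^sub>F N in sequentially. real (Ltil p) = real (Mtil N p) * inclusion_prob N p"
    by eventually_elim (simp add: inclusion_prob_def)
  then show "(\<lambda>N. real (Mtil N p) * inclusion_prob N p) \<longlonglongrightarrow> real (Ltil p)"
    by (rule Lim_transform_eventually[OF tendsto_const])
  have "(\<lambda>N. real (Ltil p) / (real (Mtil N p) / real N)) \<longlonglongrightarrow> real (Ltil p) / (exp 1 * p * \<bar>ln p\<bar>)"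
    using p by (intro tendsto_intros Mtil_ratio_tendsto) auto
  then show "(\<lambda>N. real N * inclusion_prob N p) \<longlonglongrightarrow> real (Ltil p) / (exp 1 * p * \<bar>ln p\<bar>)"
    by (simp add: inclusion_prob_def mult.commute)
qed (auto simp: inclusion_prob_def filterlim_ident)

lemma convergent_avg_cost:
  assumes p: "0 < p" "p \<le> exp (- 1)"
  shows "convergent (\<lambda>N. avg_cost N p)"
proof -
  have "p < 1" by (rule less_1_if_le_exp_minus_1[OF p])
  then interpret sparse_designs sequentially "\<lambda>N. N" "\<lambda>N. Mtil N p" "\<lambda>N. inclusion_prob N p"
    "real (Ltil p) / (exp 1 * p * \<bar>ln p\<bar>)" "real (Ltil p)"
    by (intro sparse_designs_inclusion_prob p)
  have "1 < exp 1 * \<bar>ln p\<bar>"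
    using mult_mono[OF _ abs_ln_ge_1[OF p], of 2 "exp 1"] exp_ge_add_one_self[of 1] by simp
  then have "0 < real (Ltil p)" using Ltil_bounds(2)[of p] by linarith
  then have "0 < real (Ltil p) / (exp 1 * p * \<bar>ln p\<bar>)"
    using p abs_ln_ge_1[OF p] by (intro divide_pos_pos mult_pos_pos) auto
  from mean_second_stage_converges[OF p(1) \<open>p < 1\<close> this] obtain s where
    second_stage_limit: "(\<lambda>N. mean_second_stage N (Mtil N p) (inclusion_prob N p) p / real N) \<longlonglongrightarrow> s" .
  have "(\<lambda>N. (real (Mtil N p) / real N + mean_second_stage N (Mtil N p) (inclusion_prob N p) p / real N)
      / (p * \<bar>ln p\<bar>)) \<longlonglongrightarrow> (exp 1 * p * \<bar>ln p\<bar> + s) / (p * \<bar>ln p\<bar>)"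
    using p abs_ln_ge_1[OF p] by (intro tendsto_intros Mtil_ratio_tendsto second_stage_limit) auto
  moreover have "\<forall>\<^sub>F N in sequentially.
      (real (Mtil N p) / real N + mean_second_stage N (Mtil N p) (inclusion_prob N p) p / real N)
      / (p * \<bar>ln p\<bar>) = avg_cost N p"
    using eventually_q_le_1 by eventually_elim (simp add: avg_cost_eq add_divide_distrib mult.assoc)
  ultimately show ?thesis
    by (auto simp: convergent_def dest: Lim_transform_eventually)
qed

section \<open>The two limits\<close>

lemma avg_cost_powr_tendsto:
  assumes \<beta>: "0 < \<beta>" "\<beta> < 1"
  shows "(\<lambda>N. avg_cost N (real N powr (- \<beta>))) \<longlonglongrightarrow> exp 1"
proof -
  have abs_ln: "\<bar>ln (real N powr (- \<beta>))\<bar> = \<beta> * ln (real N)" if "N > 0" for N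
    using that \<beta> by (simp add: ln_powr abs_mult)
  have "\<forall>\<^sub>F N in sequentially. 4 * (\<beta> * ln (real N)) ^ 3 \<le> real N powr (1 - \<beta>)"
    using \<beta> by real_asymp
  moreover have "\<forall>\<^sub>F N in sequentially. real N powr (- \<beta>) \<le> exp (- 1)"
    using \<beta> by real_asymp
  ultimately have "\<forall>\<^sub>F N in sequentially.
      norm (avg_cost N (real N powr (- \<beta>)) - exp 1) \<le> (exp 4 + 2) / (\<beta> * ln (real N))"
    using eventually_gt_at_top[of 0]
  proof eventually_elim
    case (elim N)
    have "real N * real N powr (- \<beta>) = real N powr (1 - \<beta>)"
      using elim powr_add[of "real N" 1 "- \<beta>"] by simp
    then have "4 * \<bar>ln (real N powr (- \<beta>))\<bar> ^ 3 \<le> real N * real N powr (- \<beta>)"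
      unfolding abs_ln[OF elim(3)] using elim(1) by simp
    from abs_avg_cost_diff_le[OF _ elim(2) this] show ?case
      unfolding abs_ln[OF elim(3)] real_norm_def using elim(3) by simp
  qed
  moreover have "(\<lambda>N. (exp 4 + 2) / (\<beta> * ln (real N))) \<longlonglongrightarrow> 0"
    using \<beta> by real_asymp
  ultimately show ?thesis
    by (rule LIM_zero_cancel[OF Lim_null_comparison])
qed

lemma lim_avg_cost_tendsto: "((\<lambda>p. lim (\<lambda>N. avg_cost N p)) \<longlongrightarrow> exp 1) (at_right 0)"
proof -
  have "\<forall>\<^sub>F p :: real in at_right 0. 0 < p \<and> p \<le> exp (- 1)"
    unfolding eventually_at_right_field by (intro exI[of _ "exp (- 1)"]) auto
  then have "\<forall>\<^sub>F p in at_right 0. norm (lim (\<lambda>N. avg_cost N p) - exp 1) \<le> (exp 4 + 2) / \<bar>ln p\<bar>"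
  proof eventually_elim
    case (elim p)
    have "(\<lambda>N. \<bar>avg_cost N p - exp 1\<bar>) \<longlonglongrightarrow> \<bar>lim (\<lambda>N. avg_cost N p) - exp 1\<bar>"
      using convergent_avg_cost elim by (intro tendsto_intros) (simp add: convergent_LIMSEQ_iff)
    moreover have "\<forall>\<^sub>F N in sequentially. 4 * \<bar>ln p\<bar> ^ 3 \<le> real N * p"
      using elim by real_asymp
    then have "\<forall>\<^sub>F N in sequentially. \<bar>avg_cost N p - exp 1\<bar> \<le> (exp 4 + 2) / \<bar>ln p\<bar>"
      by eventually_elim (use abs_avg_cost_diff_le elim in blast)
    ultimately show ?case unfolding real_norm_def by (rule tendsto_upperbound) simp
  qed
  moreover have "((\<lambda>p :: real. (exp 4 + 2) / \<bar>ln p\<bar>) \<longlongrightarrow> 0) (at_right 0)"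
    by real_asymp
  ultimately show ?thesis
    by (rule LIM_zero_cancel[OF Lim_null_comparison])
qed

theorem theorem5:
  fixes \<beta> :: real
  assumes "0 \<le> \<beta>" and "\<beta> < 1"
  shows "(\<beta> > 0 \<longrightarrow> (\<lambda>N. avg_cost N (real N powr (-\<beta>))) \<longlonglongrightarrow> exp 1) \<and>
         (\<beta> = 0 \<longrightarrow> (\<exists>g. (\<forall>\<^sub>F p in at_right 0. (\<lambda>N. avg_cost N p) \<longlonglongrightarrow> g p) \<and>
                          (g \<longlongrightarrow> exp 1) (at_right 0)))"
proof (intro conjI impI exI)
  show "(\<lambda>N. avg_cost N (real N powr (-\<beta>))) \<longlonglongrightarrow> exp 1" if "\<beta> > 0"
    using that assms(2) by (rule avg_cost_powr_tendsto)
  show "\<forall>\<^sub>F p in at_right 0. (\<lambda>N. avg_cost N p) \<longlonglongrightarrow> lim (\<lambda>N. avg_cost N p)"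
    unfolding eventually_at_right_field
    using convergent_avg_cost by (intro exI[of _ "exp (- 1)"]) (auto simp: convergent_LIMSEQ_iff)
  show "((\<lambda>p. lim (\<lambda>N. avg_cost N p)) \<longlongrightarrow> exp 1) (at_right 0)"
    by (rule lim_avg_cost_tendsto)
qed

end
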